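(* Let $n,d$ be positive integers with $n\ge3$ and $d\ge4$, or with $n=2$ and $d\ge6$. Let $m_1,\dots,m_N$ be the non-constant monomials of degree $\le d$ in $(x_1,\dots,x_n)$ (so $N=\binom{n+d}{n}-1$). Then for any semi-algebraic set $S\subseteq\mathbb{R}^n$ with non-empty interior, the closed convex hull of $$v(S)=\bigl\{\bigl(m_1(\xi),\dots,m_N(\xi)\bigr):\xi\in S\bigr\}$$ in $\mathbb{R}^N$ fails to be a spectrahedral shadow.
   Context: A spectrahedron in $\mathbb{R}^M$ is a set of the form $\{\xi\in\mathbb{R}^M : A_0+\sum_{i=1}^M\xi_iA_i\succeq 0\}$ with $A_0,\dots,A_M$ real symmetric $e\times e$ matrices for some $e\ge1$ ($\succeq0$ means positive semidefinite). A set $K\subseteq\mathbb{R}^N$ is a spectrahedral shadow if $K=f(T)$ for some spectrahedron $T\subseteq\mathbb{R}^M$, some $M$, and some linear map $f\colon\mathbb{R}^M\to\mathbb{R}^N$. The closed convex hull is the euclidean closure of the convex hull. *)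

theory Defs
  imports "HOL-Analysis.Analysis" "Jordan_Normal_Form.Matrix"
begin

text \<open>
  The ambient spaces \<open>\<real>\<^sup>n\<close> and \<open>\<real>\<^sup>N\<close>, where \<open>n\<close> and \<open>N\<close> are fixed and topology is needed, are
  the types \<open>real ^ 'n\<close> and \<open>real ^ 'N\<close>.  The size \<open>e\<close> of a linear matrix inequality and the
  dimension \<open>M\<close> of the space it lives in are existentially quantified, hence cannot be types: there
  we use the matrices and vectors of \<open>Jordan_Normal_Form.Matrix\<close>, whose dimensions are explicit.
\<close>

text \<open>Both \<open>$\<close> and \<open>\<bullet>\<close> are overloaded in the two libraries.  Below, \<open>$\<close> is the component of a
  vector in \<^typ>\<open>real ^ 'n\<close>, and \<open>\<bullet>\<close> is the standard scalar product of \<open>Jordan_Normal_Form.Matrix\<close>.\<close>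

no_notation Matrix.vec_index (infixl \<open>$\<close> 100)
no_notation inner (infix \<open>\<bullet>\<close> 70)

text \<open>The smallest class of sets that contains all \<open>{x. p x > 0}\<close>, \<open>p\<close> a real polynomial, and is
  closed under finite unions, finite intersections and complements.\<close>

inductive semialgebraic :: "(real ^ 'n) set \<Rightarrow> bool" where
  pos: "real_polynomial_function p \<Longrightarrow> semialgebraic {x. p x > 0}"
| union: "semialgebraic A \<Longrightarrow> semialgebraic B \<Longrightarrow> semialgebraic (A \<union> B)"
| inter: "semialgebraic A \<Longrightarrow> semialgebraic B \<Longrightarrow> semialgebraic (A \<inter> B)"
| compl: "semialgebraic A \<Longrightarrow> semialgebraic (- A)"

definition symmetric_mat :: "nat \<Rightarrow> real mat \<Rightarrow> bool" where
  "symmetric_mat e A \<longleftrightarrow> A \<in> carrier_mat e e \<and> transpose_mat A = A"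

definition psd_mat :: "nat \<Rightarrow> real mat \<Rightarrow> bool" where
  "psd_mat e A \<longleftrightarrow> symmetric_mat e A \<and> (\<forall>v \<in> carrier_vec e. v \<bullet> (A *\<^sub>v v) \<ge> 0)"

text \<open>The pencil \<open>A\<^sub>0 + \<xi>\<^sub>1 A\<^sub>1 + \<dots> + \<xi>\<^sub>M A\<^sub>M\<close> of \<open>e \<times> e\<close> matrices, written entrywise (there is no
  sum operator over index sets for matrices of explicit dimension).  Vector components are counted
  from 0, so \<open>\<xi>\<^sub>i\<close> is component \<open>i - 1\<close>.\<close>

definition linear_pencil :: "nat \<Rightarrow> nat \<Rightarrow> (nat \<Rightarrow> real mat) \<Rightarrow> real Matrix.vec \<Rightarrow> real mat" where
  "linear_pencil e M A \<xi> =
     Matrix.mat e e (\<lambda>(r, s). A 0 $$ (r, s) + (\<Sum>i = 1..M. vec_index \<xi> (i - 1) * A i $$ (r, s)))"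

definition spectrahedron :: "nat \<Rightarrow> real Matrix.vec set \<Rightarrow> bool" where
  "spectrahedron M T \<longleftrightarrow>
     (\<exists>e A. e \<ge> 1 \<and> (\<forall>i \<le> M. symmetric_mat e (A i)) \<and>
        T = {\<xi> \<in> carrier_vec M. psd_mat e (linear_pencil e M A \<xi>)})"

text \<open>Linearity of a map \<open>\<real>\<^sup>M \<rightarrow> \<real>\<^sup>N\<close>; its values outside \<open>\<real>\<^sup>M\<close> are irrelevant.\<close>

definition linear_from :: "nat \<Rightarrow> (real Matrix.vec \<Rightarrow> real ^ 'N) \<Rightarrow> bool" where
  "linear_from M f \<longleftrightarrow>
     (\<forall>x \<in> carrier_vec M. \<forall>y \<in> carrier_vec M. f (x + y) = f x + f y) \<and>
     (\<forall>c. \<forall>x \<in> carrier_vec M. f (c \<cdot>\<^sub>v x) = c *\<^sub>R f x)"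

definition spectrahedral_shadow :: "(real ^ 'N) set \<Rightarrow> bool" where
  "spectrahedral_shadow K \<longleftrightarrow> (\<exists>M T f. spectrahedron M T \<and> linear_from M f \<and> K = f ` T)"

text \<open>A monomial in the variables \<open>x\<^sub>i\<close>, \<open>i :: 'n\<close>, is given by its exponents.\<close>

definition nonconst_monomials :: "nat \<Rightarrow> ('n::finite \<Rightarrow> nat) set" where
  "nonconst_monomials d = {\<alpha>. 1 \<le> (\<Sum>i\<in>UNIV. \<alpha> i) \<and> (\<Sum>i\<in>UNIV. \<alpha> i) \<le> d}"

definition monomial_value :: "('n \<Rightarrow> nat) \<Rightarrow> real ^ 'n \<Rightarrow> real" where
  "monomial_value \<alpha> \<xi> = (\<Prod>i\<in>UNIV. (\<xi> $ i) ^ \<alpha> i)"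

definition monomial_map :: "('N \<Rightarrow> 'n \<Rightarrow> nat) \<Rightarrow> real ^ 'n \<Rightarrow> real ^ 'N" where
  "monomial_map m \<xi> = (\<chi> j. monomial_value (m j) \<xi>)"

end

theory Submission
  imports Defs "HOL-Computational_Algebra.Formal_Power_Series"
begin

text \<open>
  Suppose the closed convex hull \<open>V\<close> is the image of a spectrahedron \<open>T\<close> under a linear map \<open>f\<close>, and
  let \<open>k\<close> be the countable ring generated by the coefficients of the pencil and of \<open>f\<close>.  Choose a
  point \<open>x \<in> S\<close> two or three of whose coordinates are algebraically independent over \<open>k\<close>, and a
  lift \<open>\<xi> \<in> T\<close> of its monomial vector.  Derivations of the reals over \<open>k\<close> exponentiate to a ring
  homomorphism \<open>\<phi>\<close> from the reals to \<open>\<real>[[t\<^sub>1, t\<^sub>2]]\<close> over \<open>k\<close> that moves \<open>x\<close> in a prescribed way.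

  Write the pencil at \<open>\<xi>\<close> as \<open>C\<^sup>T C\<close>.  If a real functional \<open>\<Lambda>\<close> on the power series, normalised by
  \<open>\<Lambda> 1 = 1\<close>, is nonnegative on the squares of the real combinations of the finitely many series
  \<open>\<phi> C\<^sub>l\<^sub>s\<close>, then \<open>\<Lambda> (\<phi> \<xi>)\<close> again lies in \<open>T\<close>, so the vector of the pseudo-moments
  \<open>\<Lambda> (\<phi> (m\<^sub>j x))\<close> lies in \<open>V\<close>, and every nonnegative polynomial of degree at most \<open>d\<close> must have
  a nonnegative pseudo-expectation.

  On a finite-dimensional space of power series all coefficients are controlled by those of some
  bounded degree.  Hence a functional that is positive definite on squares of polynomials of that
  degree becomes, after rescaling the variables by a small \<open>\<epsilon>\<close>, nonnegative on squares from the
  space.  Such a functional can be negative on Motzkin's polynomial, which is nonnegative but not a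
  sum of squares: a contradiction.
\<close>

section \<open>Derivations of the real numbers\<close>

definition subring_set :: "real set \<Rightarrow> bool" where
  "subring_set k \<longleftrightarrow> 1 \<in> k \<and> (\<forall>a\<in>k. \<forall>b\<in>k. a - b \<in> k \<and> a * b \<in> k)"

inductive_set ring_hull :: "real set \<Rightarrow> real set" for Y where
  base: "y \<in> Y \<Longrightarrow> y \<in> ring_hull Y"
| one: "1 \<in> ring_hull Y"
| diff: "a \<in> ring_hull Y \<Longrightarrow> b \<in> ring_hull Y \<Longrightarrow> a - b \<in> ring_hull Y"
| mult: "a \<in> ring_hull Y \<Longrightarrow> b \<in> ring_hull Y \<Longrightarrow> a * b \<in> ring_hull Y"

lemma subring_set_ring_hull: "subring_set (ring_hull Y)"
  by (simp add: subring_set_def ring_hull.intros)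

text \<open>Closing under differences and products stage by stage keeps every stage countable.
  Countability of the coefficient ring is what leaves transcendental numbers in every
  interval.\<close>

lemma countable_ring_hull:
  assumes "countable Y"
  shows "countable (ring_hull Y)"
proof -
  define step where "step = (\<lambda>X::real set. X \<union> (\<lambda>(a, b). a - b) ` (X \<times> X) \<union> (\<lambda>(a, b). a * b) ` (X \<times> X))"
  define K where "K = (\<lambda>n. (step ^^ n) (insert 1 Y))"
  have K_Suc: "K (Suc n) = step (K n)" for n
    by (simp add: K_def)
  have cK: "countable (K n)" for n
  proof (induction n)
    case 0
    then show ?case using assms by (simp add: K_def)
  next
    case (Suc n)
    then show ?case unfolding K_Suc step_def by blast
  qed
  have mono: "K n \<subseteq> K m" if "n \<le> m" for n m
    by (rule lift_Suc_mono_le[OF _ that]) (auto simp: K_Suc step_def)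
  have "a \<in> (\<Union>n. K n)" if "a \<in> ring_hull Y" for a
    using that
  proof induction
    case (base y)
    then have "y \<in> K 0" by (simp add: K_def)
    then show ?case by blast
  next
    case one
    have "1 \<in> K 0" by (simp add: K_def)
    then show ?case by blast
  next
    case (diff a b)
    then obtain n m where "a \<in> K n" "b \<in> K m" by blast
    then have "a \<in> K (max n m)" "b \<in> K (max n m)"
      using mono[of n "max n m"] mono[of m "max n m"] by auto
    then have "a - b \<in> K (Suc (max n m))"
      unfolding K_Suc step_def by force
    then show ?case by blast
  next
    case (mult a b)
    then obtain n m where "a \<in> K n" "b \<in> K m" by blast
    then have "a \<in> K (max n m)" "b \<in> K (max n m)"
      using mono[of n "max n m"] mono[of m "max n m"] by auto
    then have "a * b \<in> K (Suc (max n m))"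
      unfolding K_Suc step_def by force
    then show ?case by blast
  qed
  then have "ring_hull Y \<subseteq> (\<Union>n. K n)" by blast
  then show ?thesis
    by (rule countable_subset) (simp add: cK)
qed

definition polys_over :: "real set \<Rightarrow> real poly set" where
  "polys_over k = {p. \<forall>i. coeff p i \<in> k}"

definition transcendental_over :: "real set \<Rightarrow> real \<Rightarrow> bool" where
  "transcendental_over k a \<longleftrightarrow> (\<forall>p \<in> polys_over k. poly p a = 0 \<longrightarrow> p = 0)"

lemma countable_polys_over:
  assumes "countable k"
  shows "countable (polys_over k)"
proof (rule countable_subset)
  show "polys_over k \<subseteq> Poly ` lists k"
  proof
    fix p :: "real poly"
    assume "p \<in> polys_over k"
    then have "coeffs p \<in> lists k"
      by (auto simp: polys_over_def coeffs_def)
    then show "p \<in> Poly ` lists k"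
      by (metis Poly_coeffs imageI)
  qed
  show "countable (Poly ` lists k)"
    using assms by blast
qed

text \<open>Nonzero polynomials over \<open>k\<close> have only countably many roots altogether,
  while an interval is uncountable.\<close>

lemma exists_transcendental:
  assumes "countable k" "l < (r::real)"
  shows "\<exists>a\<in>{l<..<r}. transcendental_over k a"
proof -
  define B where "B = (\<Union>p\<in>polys_over k - {0}. {a. poly p a = 0})"
  have "countable B"
    unfolding B_def
    using countable_polys_over[OF assms(1)] by (intro countable_UN) (auto intro: countable_finite poly_roots_finite)
  then have "\<not> {l<..<r} \<subseteq> B"
    using uncountable_open_interval[of l r] assms(2) countable_subset by blast
  then show ?thesis
    unfolding B_def transcendental_over_def by blast
qed

text \<open>The ring k[a], for a subring k. Clearing denominators shows that transcendence over it
  is the same as over its field of fractions, so a tower of rings suffices.\<close>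

definition ring_adjoin :: "real set \<Rightarrow> real \<Rightarrow> real set" where
  "ring_adjoin k a = (\<lambda>p. poly p a) ` polys_over k"

lemma countable_ring_adjoin: "countable k \<Longrightarrow> countable (ring_adjoin k a)"
  unfolding ring_adjoin_def using countable_polys_over by blast

text \<open>The graph of a derivation on a subring of the reals is a subring of the dual numbers that
  meets the ideal of infinitesimals only in zero.\<close>

definition derivation_graph :: "(real \<times> real) set \<Rightarrow> bool" where
  "derivation_graph G \<longleftrightarrow> (1, 0) \<in> G
     \<and> (\<forall>a u b v. (a, u) \<in> G \<longrightarrow> (b, v) \<in> G \<longrightarrow> (a - b, u - v) \<in> G \<and> (a * b, a * v + u * b) \<in> G)
     \<and> (\<forall>u. (0, u) \<in> G \<longrightarrow> u = 0)"

lemma derivation_graph_zero: "derivation_graph G \<Longrightarrow> (0, 0) \<in> G"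
  unfolding derivation_graph_def by (metis diff_self)

lemma derivation_graph_add:
  assumes "derivation_graph G" "(a, u) \<in> G" "(b, v) \<in> G"
  shows "(a + b, u + v) \<in> G"
proof -
  have "(0 - b, 0 - v) \<in> G"
    using assms derivation_graph_zero[of G] unfolding derivation_graph_def by blast
  then have "(a - (0 - b), u - (0 - v)) \<in> G"
    using assms unfolding derivation_graph_def by blast
  then show ?thesis by simp
qed

lemma derivation_graph_mult:
  "derivation_graph G \<Longrightarrow> (a, u) \<in> G \<Longrightarrow> (b, v) \<in> G \<Longrightarrow> (a * b, a * v + u * b) \<in> G"
  unfolding derivation_graph_def by blast

lemma derivation_graph_diff:
  "derivation_graph G \<Longrightarrow> (a, u) \<in> G \<Longrightarrow> (b, v) \<in> G \<Longrightarrow> (a - b, u - v) \<in> G"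
  unfolding derivation_graph_def by blast

lemma derivation_graph_sum:
  assumes "derivation_graph G" "\<And>i. i \<in> I \<Longrightarrow> (f i, g i) \<in> G"
  shows "(sum f I, sum g I) \<in> G"
  using assms(2)
proof (induction I rule: infinite_finite_induct)
  case (insert i I)
  then show ?case using derivation_graph_add[OF assms(1)] by simp
qed (use derivation_graph_zero[OF assms(1)] in auto)

section \<open>Adjoining one element to the domain of a derivation\<close>

text \<open>A pair \<open>(p, q)\<close> stands for the polynomial p + eps q over the dual numbers,
  eps^2 = 0. Its value at a + eps u is p(a) + eps (q(a) + u p'(a)), so \<open>graph_adjoin\<close>
  is the ring G[a + eps u].\<close>

definition graph_polys :: "(real \<times> real) set \<Rightarrow> (real poly \<times> real poly) set" where
  "graph_polys G = {(p, q). \<forall>i. (coeff p i, coeff q i) \<in> G}"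

definition graph_adjoin :: "(real \<times> real) set \<Rightarrow> real \<Rightarrow> real \<Rightarrow> (real \<times> real) set" where
  "graph_adjoin G a u = (\<lambda>(p, q). (poly p a, poly q a + u * poly (pderiv p) a)) ` graph_polys G"

lemma graph_polys_mult:
  assumes "derivation_graph G" "(p, q) \<in> graph_polys G" "(p', q') \<in> graph_polys G"
  shows "(p * p', p * q' + q * p') \<in> graph_polys G"
  using assms(2,3) unfolding graph_polys_def
  by (auto simp: coeff_mult simp flip: sum.distrib
      intro!: derivation_graph_sum[OF assms(1)] derivation_graph_mult[OF assms(1)])

lemma graph_polys_diff:
  assumes "derivation_graph G" "(p, q) \<in> graph_polys G" "(p', q') \<in> graph_polys G"
  shows "(p - p', q - q') \<in> graph_polys G"
  using assms(2,3) unfolding graph_polys_def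
  by (auto intro!: derivation_graph_diff[OF assms(1)])

lemma graph_polys_const:
  assumes "derivation_graph G" "(a, u) \<in> G"
  shows "([:a:], [:u:]) \<in> graph_polys G"
  using assms derivation_graph_zero[OF assms(1)] unfolding graph_polys_def
  by (auto simp: coeff_pCons split: nat.split)

lemma graph_polys_monom:
  assumes "derivation_graph G" "(a, u) \<in> G"
  shows "(monom a n, monom u n) \<in> graph_polys G"
  using assms derivation_graph_zero[OF assms(1)] unfolding graph_polys_def
  by (auto simp: coeff_monom)

text \<open>G[a + eps u] is a subring of the dual numbers in any case; \<open>sv\<close> supplies
  the remaining point, that it contains no nonzero infinitesimal.\<close>

lemma derivation_graph_adjoin:
  assumes G: "derivation_graph G"
    and sv: "\<And>p q. (p, q) \<in> graph_polys G \<Longrightarrow> poly p a = 0 \<Longrightarrow> poly q a + u * poly (pderiv p) a = 0"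
  shows "derivation_graph (graph_adjoin G a u)"
  unfolding derivation_graph_def
proof (intro conjI allI impI)
  have "([:1:], [:0:]) \<in> graph_polys G"
    using G by (intro graph_polys_const) (auto simp: derivation_graph_def)
  then show "(1, 0) \<in> graph_adjoin G a u"
    unfolding graph_adjoin_def by force
next
  fix b v c w
  assume "(b, v) \<in> graph_adjoin G a u" "(c, w) \<in> graph_adjoin G a u"
  then obtain p q p' q' where pq: "(p, q) \<in> graph_polys G" "(p', q') \<in> graph_polys G"
    and eqs: "b = poly p a" "v = poly q a + u * poly (pderiv p) a"
      "c = poly p' a" "w = poly q' a + u * poly (pderiv p') a"
    unfolding graph_adjoin_def by auto
  show "(b - c, v - w) \<in> graph_adjoin G a u"
    unfolding graph_adjoin_def using graph_polys_diff[OF G pq]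
    by (rule rev_image_eqI) (simp add: eqs pderiv_diff algebra_simps)
  show "(b * c, b * w + v * c) \<in> graph_adjoin G a u"
    unfolding graph_adjoin_def using graph_polys_mult[OF G pq]
    by (rule rev_image_eqI) (simp add: eqs pderiv_mult algebra_simps)
next
  fix w assume "(0, w) \<in> graph_adjoin G a u"
  then show "w = 0" unfolding graph_adjoin_def using sv by auto
qed

lemma subset_graph_adjoin:
  assumes "derivation_graph G"
  shows "G \<subseteq> graph_adjoin G a u"
proof
  fix x assume "x \<in> G"
  then have "([:fst x:], [:snd x:]) \<in> graph_polys G"
    using assms by (intro graph_polys_const) auto
  then show "x \<in> graph_adjoin G a u"
    unfolding graph_adjoin_def by (rule rev_image_eqI) (simp add: pderiv_pCons)
qed

lemma mem_graph_adjoin: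
  assumes "derivation_graph G"
  shows "(a, u) \<in> graph_adjoin G a u"
proof -
  have "(monom 1 1, monom 0 1) \<in> graph_polys G"
    using assms by (intro graph_polys_monom) (auto simp: derivation_graph_def)
  then show ?thesis
    unfolding graph_adjoin_def by (rule rev_image_eqI) (simp add: poly_monom pderiv_monom)
qed

lemma fst_graph_adjoin: "fst ` graph_adjoin G a u \<subseteq> ring_adjoin (fst ` G) a"
  unfolding graph_adjoin_def ring_adjoin_def graph_polys_def polys_over_def by force

lemma transcendental_over_mono:
  "transcendental_over k a \<Longrightarrow> l \<subseteq> k \<Longrightarrow> transcendental_over l a"
  unfolding transcendental_over_def polys_over_def by blast

lemma ring_adjoin_mono: "k \<subseteq> l \<Longrightarrow> ring_adjoin k a \<subseteq> ring_adjoin l a"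
  unfolding ring_adjoin_def polys_over_def by blast

lemma graph_polys_zero:
  assumes "derivation_graph G" "(0, q) \<in> graph_polys G"
  shows "q = 0"
proof -
  have "(0, coeff q i) \<in> G" for i
    using assms(2) unfolding graph_polys_def by auto
  then have "coeff q i = 0" for i
    using assms(1) unfolding derivation_graph_def by blast
  then show ?thesis by (simp add: poly_eq_iff)
qed

text \<open>No nontrivial relation constrains \<open>a\<close>, so its derivative \<open>u\<close>
  can be prescribed at will.\<close>

lemma derivation_graph_adjoin_transcendental:
  assumes G: "derivation_graph G" and a: "transcendental_over (fst ` G) a"
  shows "derivation_graph (graph_adjoin G a u)"
proof (rule derivation_graph_adjoin[OF G])
  fix p q assume pq: "(p, q) \<in> graph_polys G" "poly p a = 0"
  have "p \<in> polys_over (fst ` G)"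
    using pq(1) unfolding graph_polys_def polys_over_def by force
  with a pq(2) have "p = 0" unfolding transcendental_over_def by blast
  with graph_polys_zero[OF G] pq(1) show "poly q a + u * poly (pderiv p) a = 0" by fastforce
qed

text \<open>Both products have the coefficient \<open>lead_coeff m * lead_coeff p\<close> in degree
  \<open>degree p\<close>, and it cancels.\<close>

lemma degree_pseudo_division_step:
  fixes p m :: "real poly"
  assumes "p \<noteq> 0" "m \<noteq> 0" "degree m \<le> degree p"
  defines "r \<equiv> [:lead_coeff m:] * p - monom (lead_coeff p) (degree p - degree m) * m"
  shows "r = 0 \<or> degree r < degree p"
proof -
  have 1: "degree ([:l:] * p) = degree p" if "l \<noteq> 0" for l :: real
    using that by (simp add: degree_smult_eq)
  have 2: "degree (monom c k * m) = k + degree m" if "c \<noteq> 0" for c :: real and k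
    using that assms(2) by (simp add: degree_mult_eq degree_monom_eq)
  have "degree r \<le> degree p"
    unfolding r_def
  proof (rule degree_diff_le)
    show "degree ([:lead_coeff m:] * p) \<le> degree p"
      using 1[of "lead_coeff m"] assms(2) by force
    show "degree (monom (lead_coeff p) (degree p - degree m) * m) \<le> degree p"
      using 2[of "lead_coeff p" "degree p - degree m"] assms(1,3) by force
  qed
  moreover have "coeff (monom c k * m) (k + degree m) = c * lead_coeff m" for c k
    by (simp add: coeff_monom_mult)
  from this[of "lead_coeff p" "degree p - degree m"] have "coeff r (degree p) = 0"
    using assms(3) by (simp add: r_def)
  ultimately show ?thesis
    using eq_zero_or_degree_less by blast
qed

text \<open>Pseudo-division by a relation of minimal degree replaces division by the minimal polynomial,
  so the domain of the derivation need not be a field.\<close>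

lemma derivation_graph_adjoin_algebraic:
  assumes G: "derivation_graph G" and a: "\<not> transcendental_over (fst ` G) a"
  shows "\<exists>u. derivation_graph (graph_adjoin G a u)"
proof -
  define P where "P = (\<lambda>(p, q). (p, q) \<in> graph_polys G \<and> p \<noteq> 0 \<and> poly p a = 0)"
  obtain p0 where p0: "p0 \<in> polys_over (fst ` G)" "poly p0 a = 0" "p0 \<noteq> 0"
    using a unfolding transcendental_over_def by blast
  have "\<exists>w. (coeff p0 i, w) \<in> G" for i
    using p0(1) unfolding polys_over_def by force
  then obtain W where W: "\<And>i. (coeff p0 i, W i) \<in> G" by metis
  \<comment> \<open>The choices \<open>W i\<close> beyond \<open>degree p0\<close> are dropped so
    that \<open>q0\<close> is a polynomial; there \<open>(0, 0)\<close> is the pair of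
    coefficients.\<close>
  define q0 where "q0 = (\<Sum>i\<le>degree p0. monom (W i) i)"
  have cq0: "coeff q0 i = W i" if "i \<le> degree p0" for i
    using that by (simp add: q0_def coeff_sum)
  have cq0': "coeff q0 i = 0" if "\<not> i \<le> degree p0" for i
    using that by (auto simp: q0_def coeff_sum intro!: sum.neutral)
  have "(coeff p0 i, coeff q0 i) \<in> G" for i
    using cq0[of i] cq0'[of i] W[of i] derivation_graph_zero[OF G] coeff_eq_0[of p0 i]
    by (cases "i \<le> degree p0") auto
  then have "P (p0, q0)"
    using p0 unfolding P_def graph_polys_def by auto
  then obtain m n where mn: "P (m, n)" and
    min: "\<And>p q. P (p, q) \<Longrightarrow> degree m \<le> degree p"
    using ex_has_least_nat[of P "(p0, q0)" "\<lambda>x. degree (fst x)"] by (metis fst_conv surj_pair)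
  have m: "(m, n) \<in> graph_polys G" "m \<noteq> 0" "poly m a = 0"
    using mn unfolding P_def by auto
  have dm: "degree m > 0"
    using m(2,3) by (cases "degree m = 0") (auto elim!: degree_eq_zeroE)
  \<comment> \<open>Otherwise the derivative of \<open>m\<close>, nonzero in characteristic zero,
    would be a relation of smaller degree.\<close>
  have m'a: "poly (pderiv m) a \<noteq> 0"
  proof
    assume *: "poly (pderiv m) a = 0"
    have nat_mult: "(of_nat j * x, of_nat j * y) \<in> G" if "(x, y) \<in> G" for j x y
      by (induction j) (use derivation_graph_zero[OF G] derivation_graph_add[OF G] that in \<open>auto simp: algebra_simps\<close>)
    have "(pderiv m, pderiv n) \<in> graph_polys G"
      using m(1) nat_mult unfolding graph_polys_def by (auto simp: coeff_pderiv simp del: of_nat_Suc)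
    moreover have "pderiv m \<noteq> 0" using dm pderiv_eq_0_iff[of m] by auto
    ultimately have "P (pderiv m, pderiv n)" using * by (simp add: P_def)
    then have "degree m \<le> degree (pderiv m)" by (rule min)
    then show False using dm by (simp add: degree_pderiv)
  qed
  \<comment> \<open>This value is forced by differentiating the relation m(a) = 0.\<close>
  define u where "u = - poly n a / poly (pderiv m) a"
  have \<Delta>m: "poly n a + u * poly (pderiv m) a = 0"
    using m'a by (simp add: u_def)
  have "poly q a + u * poly (pderiv p) a = 0"
    if "(p, q) \<in> graph_polys G" "poly p a = 0" for p q
    using that
  \<comment> \<open>The zero polynomial gets measure 0, strictly below the nonzero constants, whose
    degree is 0 as well.\<close>
  proof (induction "if p = 0 then 0 else Suc (degree p)" arbitrary: p q rule: less_induct)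
    case less
    show ?case
    proof (cases "p = 0")
      case True
      then show ?thesis using graph_polys_zero[OF G, of q] less.prems(1) by simp
    next
      case False
      then have "P (p, q)" using less.prems by (simp add: P_def)
      then have le: "degree m \<le> degree p" by (rule min)
      define k where "k = degree p - degree m"
      let ?l = "lead_coeff m" and ?c = "lead_coeff p"
      define l' where "l' = coeff n (degree m)"
      define c' where "c' = coeff q (degree p)"
      have l: "(?l, l') \<in> G" using m(1) unfolding graph_polys_def l'_def by auto
      have c: "(?c, c') \<in> G" using less.prems(1) unfolding graph_polys_def c'_def by auto
      \<comment> \<open>The pseudo-remainder is formed over the dual numbers: p + eps q is
        multiplied by \<open>?l\<close> + eps \<open>l'\<close>, and (\<open>?c\<close> + eps
        \<open>c'\<close>) X^k (m + eps n) is subtracted.\<close>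
      define p1 where "p1 = [:?l:] * p - monom ?c k * m"
      define q1 where "q1 = ([:?l:] * q + [:l':] * p) - (monom ?c k * n + monom c' k * m)"
      have g1: "(p1, q1) \<in> graph_polys G"
        unfolding p1_def q1_def
        by (intro graph_polys_diff graph_polys_mult graph_polys_const graph_polys_monom G l c m less.prems)
      have "poly p1 a = 0" using m(3) less.prems(2) by (simp add: p1_def)
      moreover have "(if p1 = 0 then 0 else Suc (degree p1)) < (if p = 0 then 0 else Suc (degree p))"
      proof (cases "p1 = 0")
        case True
        then show ?thesis using False by simp
      next
        case p1: False
        then have "degree p1 < degree p"
          using degree_pseudo_division_step[OF False m(2) le] unfolding p1_def k_def by blast
        then show ?thesis using False by simp
      qed
      ultimately have "poly q1 a + u * poly (pderiv p1) a = 0"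
        using less.hyps g1 by blast
      \<comment> \<open>The terms with \<open>l'\<close> and \<open>c'\<close> carry a factor p(a)
        or m(a), hence vanish.\<close>
      moreover have "poly q1 a + u * poly (pderiv p1) a
        = ?l * (poly q a + u * poly (pderiv p) a) - ?c * a ^ k * (poly n a + u * poly (pderiv m) a)"
        using m(3) less.prems(2)
        by (simp add: p1_def q1_def poly_monom pderiv_mult pderiv_diff pderiv_pCons pderiv_smult algebra_simps)
      ultimately show ?thesis using \<Delta>m m(2) by simp
    qed
  qed
  then show ?thesis using derivation_graph_adjoin[OF G] by blast
qed

text \<open>A maximal graph exists by Zorn's lemma. Its domain is all of the reals, because any real
  number, transcendental over the domain or not, can be adjoined.\<close>

lemma derivation_extension:
  assumes G: "derivation_graph G"
  obtains D :: "real \<Rightarrow> real" where "\<And>a b. D (a + b) = D a + D b"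
    "\<And>a b. D (a * b) = a * D b + D a * b" "\<And>a u. (a, u) \<in> G \<Longrightarrow> D a = u"
proof -
  define \<A> where "\<A> = {H. derivation_graph H \<and> G \<subseteq> H}"
  have "\<exists>M\<in>\<A>. \<forall>X\<in>\<A>. M \<subseteq> X \<longrightarrow> X = M"
  proof (rule subset_Zorn_nonempty)
    show "\<A> \<noteq> {}" using G by (auto simp: \<A>_def)
    fix \<C> assume ne: "\<C> \<noteq> {}" and ch: "subset.chain \<A> \<C>"
    have dg: "derivation_graph H" "G \<subseteq> H" if "H \<in> \<C>" for H
      using that ch unfolding subset.chain_def \<A>_def by auto
    have comm: "\<exists>H\<in>\<C>. x \<in> H \<and> y \<in> H" if "x \<in> \<Union>\<C>" "y \<in> \<Union>\<C>" for x y
      using ch that unfolding subset_chain_def by (meson UnionE subsetD)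
    have "derivation_graph (\<Union>\<C>)"
      unfolding derivation_graph_def
    proof (intro conjI allI impI)
      show "(1, 0) \<in> \<Union>\<C>" using ne dg(1) unfolding derivation_graph_def by blast
      fix a u b v assume "(a, u) \<in> \<Union>\<C>" "(b, v) \<in> \<Union>\<C>"
      then obtain H where "H \<in> \<C>" "(a, u) \<in> H" "(b, v) \<in> H" using comm by blast
      with dg(1)[of H] show "(a - b, u - v) \<in> \<Union>\<C>" "(a * b, a * v + u * b) \<in> \<Union>\<C>"
        unfolding derivation_graph_def by blast+
    next
      fix u assume "(0, u) \<in> \<Union>\<C>"
      then show "u = 0" using dg(1) unfolding derivation_graph_def by blast
    qed
    then show "\<Union>\<C> \<in> \<A>" using ne dg(2) by (auto simp: \<A>_def)
  qed
  then obtain M where M: "derivation_graph M" "G \<subseteq> M"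
    and max: "\<And>X. derivation_graph X \<Longrightarrow> G \<subseteq> X \<Longrightarrow> M \<subseteq> X \<Longrightarrow> X = M"
    unfolding \<A>_def by auto
  have dom: "\<exists>u. (a, u) \<in> M" for a
  proof -
    obtain u where "derivation_graph (graph_adjoin M a u)"
      using derivation_graph_adjoin_transcendental derivation_graph_adjoin_algebraic M(1) by blast
    then have "graph_adjoin M a u = M"
      using max subset_graph_adjoin[OF M(1), of a u] M(2) by blast
    then show ?thesis using mem_graph_adjoin[OF M(1)] by metis
  qed
  define D where "D a = (SOME u. (a, u) \<in> M)" for a
  have D: "(a, D a) \<in> M" for a
    unfolding D_def by (rule someI_ex[OF dom])
  have uniq: "D a = u" if "(a, u) \<in> M" for a u
    using derivation_graph_diff[OF M(1) D[of a] that] M(1) unfolding derivation_graph_def by auto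
  show ?thesis
  proof
    show "D (a + b) = D a + D b" for a b
      by (rule uniq) (rule derivation_graph_add[OF M(1) D D])
    show "D (a * b) = a * D b + D a * b" for a b
      by (rule uniq) (rule derivation_graph_mult[OF M(1) D D])
    show "D a = u" if "(a, u) \<in> G" for a u
      using uniq that M(2) by blast
  qed
qed

text \<open>Starting from the zero derivation on \<open>k\<close>, the three independent elements
  are adjoined one after the other with freely chosen derivatives.\<close>

lemma exists_derivation:
  assumes k: "subring_set k" and a: "transcendental_over k a"
    and b: "transcendental_over (ring_adjoin k a) b"
    and c: "transcendental_over (ring_adjoin (ring_adjoin k a) b) c"
  obtains D :: "real \<Rightarrow> real" where "\<And>x y. D (x + y) = D x + D y"
    "\<And>x y. D (x * y) = x * D y + D x * y" "\<And>x. x \<in> k \<Longrightarrow> D x = 0"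
    "D a = u" "D b = v" "D c = w"
proof -
  define G0 where "G0 = (\<lambda>x. (x, 0::real)) ` k"
  have f0: "fst ` G0 \<subseteq> k" by (auto simp: G0_def)
  have G0: "derivation_graph G0"
    using k unfolding derivation_graph_def subring_set_def G0_def by auto
  define G1 where "G1 = graph_adjoin G0 a u"
  have G1: "derivation_graph G1"
    unfolding G1_def using G0 transcendental_over_mono[OF a f0] by (rule derivation_graph_adjoin_transcendental)
  have f1: "fst ` G1 \<subseteq> ring_adjoin k a"
    using fst_graph_adjoin ring_adjoin_mono[OF f0] unfolding G1_def by blast
  define G2 where "G2 = graph_adjoin G1 b v"
  have G2: "derivation_graph G2"
    unfolding G2_def using G1 transcendental_over_mono[OF b f1] by (rule derivation_graph_adjoin_transcendental)
  have f2: "fst ` G2 \<subseteq> ring_adjoin (ring_adjoin k a) b"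
    using fst_graph_adjoin ring_adjoin_mono[OF f1] unfolding G2_def by blast
  define G3 where "G3 = graph_adjoin G2 c w"
  have G3: "derivation_graph G3"
    unfolding G3_def using G2 transcendental_over_mono[OF c f2] by (rule derivation_graph_adjoin_transcendental)
  have k0: "(x, 0) \<in> G3" if "x \<in> k" for x
    using that subset_graph_adjoin G0 G1 G2 unfolding G0_def G1_def G2_def G3_def by blast
  have abc: "(a, u) \<in> G3" "(b, v) \<in> G3" "(c, w) \<in> G3"
    using mem_graph_adjoin subset_graph_adjoin G0 G1 G2 unfolding G1_def G2_def G3_def by blast+
  obtain D :: "real \<Rightarrow> real" where D: "\<And>x y. D (x + y) = D x + D y"
    "\<And>x y. D (x * y) = x * D y + D x * y" "\<And>x z. (x, z) \<in> G3 \<Longrightarrow> D x = z"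
    using derivation_extension[OF G3] by blast
  show ?thesis
    by (rule that[of D]) (simp_all add: D(1,2) D(3)[OF k0] abc[THEN D(3)])
qed

section \<open>Exponentials of derivations\<close>

definition derivation :: "(real \<Rightarrow> real) \<Rightarrow> bool" where
  "derivation D \<longleftrightarrow> (\<forall>x y. D (x + y) = D x + D y) \<and> (\<forall>x y. D (x * y) = x * D y + D x * y)"

text \<open>The formal flow exp(t D) applied to \<open>a\<close>, a power series in t.\<close>

definition exp_derivation :: "(real \<Rightarrow> real) \<Rightarrow> real \<Rightarrow> real fps" where
  "exp_derivation D a = Abs_fps (\<lambda>n. (D ^^ n) a / fact n)"

definition ring_hom_fun :: "('a::comm_ring_1 \<Rightarrow> 'b::comm_ring_1) \<Rightarrow> bool" where
  "ring_hom_fun \<phi> \<longleftrightarrow> \<phi> 1 = 1 \<and> (\<forall>x y. \<phi> (x + y) = \<phi> x + \<phi> y) \<and> (\<forall>x y. \<phi> (x * y) = \<phi> x * \<phi> y)"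

lemma ring_hom_fun_zero: "ring_hom_fun \<phi> \<Longrightarrow> \<phi> 0 = 0"
  unfolding ring_hom_fun_def by (metis add_cancel_right_right)

lemma ring_hom_fun_sum: "ring_hom_fun \<phi> \<Longrightarrow> \<phi> (sum f I) = (\<Sum>i\<in>I. \<phi> (f i))"
  by (induction I rule: infinite_finite_induct) (auto simp: ring_hom_fun_zero ring_hom_fun_def)

lemma derivation_0: "derivation D \<Longrightarrow> D 0 = 0"
  unfolding derivation_def by (metis add_cancel_right_right)

lemma derivation_1: "derivation D \<Longrightarrow> D 1 = 0"
  unfolding derivation_def by (metis add_cancel_right_right mult_1 mult_1_right)

lemma derivation_funpow_0: "derivation D \<Longrightarrow> (D ^^ n) 0 = 0"
  by (induction n) (auto simp: derivation_0)

lemma derivation_funpow_const: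
  assumes "derivation D" "D c = 0"
  shows "(D ^^ n) c = (if n = 0 then c else 0)"
  using derivation_funpow_0[OF assms(1)] assms(2) by (cases n) (auto simp: funpow_Suc_right simp del: funpow.simps)

lemma derivation_funpow_add: "derivation D \<Longrightarrow> (D ^^ n) (x + y) = (D ^^ n) x + (D ^^ n) y"
  by (induction n) (auto simp: derivation_def)

text \<open>This is the iterated Leibniz rule, divided by factorials so that it becomes a Cauchy
  product.\<close>

lemma exp_derivation_mult:
  assumes D: "derivation D"
  shows "exp_derivation D (a * b) = exp_derivation D a * exp_derivation D b"
proof -
  define g where "g = (\<lambda>a n. (D ^^ n) a / fact n :: real)"
  have scale: "D (c * x) = c * D x" if "D c = 0" for c x
    using D that unfolding derivation_def by simp
  \<comment> \<open>\<open>D\<close> is only additive and Leibniz, so that it kills rational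
    constants has to be derived before the factorials can be moved through it.\<close>
  have Dnat: "D (of_nat n) = 0" for n
    by (induction n) (use D derivation_0[OF D] derivation_1[OF D] in \<open>auto simp: derivation_def\<close>)
  have Dinv: "D (1 / of_nat n) = 0" if "n > 0" for n
  proof -
    have "D (of_nat n * (1 / of_nat n)) = of_nat n * D (1 / of_nat n)"
      by (rule scale[OF Dnat])
    then show ?thesis using that derivation_1[OF D] by simp
  qed
  have Dg: "D (g a n) = of_nat (Suc n) * g a (Suc n)" for a n
  proof -
    have "D (g a n) = D (1 / of_nat (fact n) * (D ^^ n) a)" by (simp add: g_def)
    also have "\<dots> = 1 / of_nat (fact n) * (D ^^ Suc n) a"
      by (subst scale[OF Dinv]) auto
    finally show ?thesis by (simp add: g_def)
  qed
  have Dsum: "D (sum f I) = (\<Sum>i\<in>I. D (f i))" for f and I :: "nat set"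
    by (induction I rule: infinite_finite_induct)
       (use D derivation_0[OF D] in \<open>auto simp: derivation_def\<close>)
  have "g (a * b) n = (\<Sum>i\<le>n. g a i * g b (n - i))" for n
  proof (induction n)
    case 0
    then show ?case by (simp add: g_def)
  next
    case (Suc n)
    have "of_nat (Suc n) * g (a * b) (Suc n) = D (\<Sum>i\<le>n. g a i * g b (n - i))"
      using Dg[of "a * b" n] Suc by simp
    also have "\<dots> = (\<Sum>i\<le>n. g a i * (of_nat (Suc (n - i)) * g b (Suc (n - i)))
                 + of_nat (Suc i) * g a (Suc i) * g b (n - i))"
      unfolding Dsum using D Dg unfolding derivation_def by (intro sum.cong) auto
    \<comment> \<open>After a shift of the second sum the weights of the \<open>i\<close>-th term
      are \<open>Suc n - i\<close> and \<open>i\<close>, which add up to the constant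
      \<open>Suc n\<close>.\<close>
    also have "\<dots> = (\<Sum>i\<le>n. of_nat (Suc n - i) * g a i * g b (Suc n - i))
                 + (\<Sum>i\<le>n. of_nat (Suc i) * g a (Suc i) * g b (Suc n - Suc i))"
      unfolding sum.distrib by (intro arg_cong2[where f = "(+)"] sum.cong) (auto simp: Suc_diff_le)
    also have "(\<Sum>i\<le>n. of_nat (Suc n - i) * g a i * g b (Suc n - i))
       = (\<Sum>i\<le>Suc n. of_nat (Suc n - i) * g a i * g b (Suc n - i))" by simp
    also have "(\<Sum>i\<le>n. of_nat (Suc i) * g a (Suc i) * g b (Suc n - Suc i))
       = (\<Sum>i\<le>Suc n. of_nat i * g a i * g b (Suc n - i))"
      by (subst sum.atMost_Suc_shift) simp
    also have "(\<Sum>i\<le>Suc n. of_nat (Suc n - i) * g a i * g b (Suc n - i)) + \<dots>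
       = (\<Sum>i\<le>Suc n. of_nat (Suc n) * (g a i * g b (Suc n - i)))"
      unfolding sum.distrib[symmetric]
      by (intro sum.cong) (auto simp: of_nat_diff algebra_simps simp del: of_nat_Suc)
    finally show ?case
      by (simp only: sum_distrib_left[symmetric]) simp
  qed
  then show ?thesis
    by (intro fps_ext) (simp add: exp_derivation_def g_def fps_mult_nth atMost_atLeast0)
qed

lemma ring_hom_exp_derivation:
  assumes D: "derivation D"
  shows "ring_hom_fun (exp_derivation D)"
  unfolding ring_hom_fun_def
proof (intro conjI allI)
  show "exp_derivation D 1 = 1"
    by (intro fps_ext)
       (simp add: exp_derivation_def derivation_funpow_const[OF D derivation_1[OF D]])
  show "exp_derivation D (x + y) = exp_derivation D x + exp_derivation D y" for x y
    by (intro fps_ext) (simp add: exp_derivation_def derivation_funpow_add[OF D] add_divide_distrib)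
qed (rule exp_derivation_mult[OF D])

lemma exp_derivation_const:
  assumes "derivation D" "D c = 0"
  shows "exp_derivation D c = fps_const c"
  using derivation_funpow_const[OF assms] by (intro fps_ext) (simp add: exp_derivation_def)

lemma exp_derivation_linear:
  assumes "derivation D" "D c = b" "D b = 0"
  shows "exp_derivation D c = fps_const c + fps_const b * fps_X"
proof (rule fps_ext)
  fix n
  show "fps_nth (exp_derivation D c) n = fps_nth (fps_const c + fps_const b * fps_X) n"
    using derivation_funpow_const[OF assms(1,3)] assms(2)
    by (cases n) (auto simp: exp_derivation_def funpow_Suc_right simp del: funpow.simps)
qed

text \<open>The outer variable belongs to \<open>D'\<close>, the inner one to \<open>D\<close>.\<close>

definition exp_derivation2 :: "(real \<Rightarrow> real) \<Rightarrow> (real \<Rightarrow> real) \<Rightarrow> real \<Rightarrow> real fps fps" where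
  "exp_derivation2 D D' a = Abs_fps (\<lambda>n. exp_derivation D (fps_nth (exp_derivation D' a) n))"

text \<open>Applying a ring homomorphism to each coefficient respects Cauchy products. This covers
  derivations that do not commute, such as \<open>D1\<close> and \<open>D2\<close> in the final
  proof.\<close>

lemma ring_hom_exp_derivation2:
  assumes D: "derivation D" and D': "derivation D'"
  shows "ring_hom_fun (exp_derivation2 D D')"
proof -
  note h = ring_hom_exp_derivation[OF D] and h' = ring_hom_exp_derivation[OF D']
  show ?thesis
    unfolding ring_hom_fun_def
  proof (intro conjI allI)
    have "exp_derivation D' 1 = 1" using h' by (simp add: ring_hom_fun_def)
    then show "exp_derivation2 D D' 1 = 1"
      using h ring_hom_fun_zero[OF h] by (intro fps_ext) (simp add: exp_derivation2_def ring_hom_fun_def)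
    show "exp_derivation2 D D' (x + y) = exp_derivation2 D D' x + exp_derivation2 D D' y" for x y
      using h h' by (intro fps_ext) (simp add: exp_derivation2_def ring_hom_fun_def)
    show "exp_derivation2 D D' (x * y) = exp_derivation2 D D' x * exp_derivation2 D D' y" for x y
    proof (rule fps_ext)
      fix n
      have "exp_derivation D' (x * y) = exp_derivation D' x * exp_derivation D' y"
        using h' by (simp add: ring_hom_fun_def)
      then show "fps_nth (exp_derivation2 D D' (x * y)) n
          = fps_nth (exp_derivation2 D D' x * exp_derivation2 D D' y) n"
        using h by (simp add: exp_derivation2_def fps_mult_nth ring_hom_fun_sum[OF h] ring_hom_fun_def)
    qed
  qed
qed

abbreviation fps_const2 :: "real \<Rightarrow> real fps fps" where
  "fps_const2 c \<equiv> fps_const (fps_const c)"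

lemma exp_derivation2_linear:
  assumes D: "derivation D" and D': "derivation D'" and "D' c = b" "D' b = 0"
  shows "exp_derivation2 D D' c
    = fps_const (exp_derivation D c) + fps_const (exp_derivation D b) * fps_X"
proof (rule fps_ext)
  fix n
  have "exp_derivation D 0 = 0"
    using ring_hom_fun_zero ring_hom_exp_derivation[OF D] by blast
  then show "fps_nth (exp_derivation2 D D' c) n
      = fps_nth (fps_const (exp_derivation D c) + fps_const (exp_derivation D b) * fps_X) n"
    using exp_derivation_linear[OF D' assms(3,4)] by (cases n) (auto simp: exp_derivation2_def fps_X_def)
qed

lemma exp_derivation2_const:
  assumes D: "derivation D" and D': "derivation D'" and "D c = 0" "D' c = 0"
  shows "exp_derivation2 D D' c = fps_const2 c"
proof -
  have "exp_derivation D 0 = 0"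
    using ring_hom_fun_zero ring_hom_exp_derivation[OF D] by blast
  with exp_derivation2_linear[OF D D' assms(4) derivation_0[OF D']] exp_derivation_const[OF D assms(3)]
  show ?thesis by simp
qed

section \<open>Quadratic forms\<close>

text \<open>The Gram factorization C^T C, by completing the square in the last variable and
  induction on the size.\<close>

lemma psd_factorization:
  fixes a :: "nat \<Rightarrow> nat \<Rightarrow> real"
  assumes "\<And>r s. r < e \<Longrightarrow> s < e \<Longrightarrow> a r s = a s r"
    and "\<And>v. 0 \<le> (\<Sum>r<e. \<Sum>s<e. v r * v s * a r s)"
  shows "\<exists>C. \<forall>r<e. \<forall>s<e. a r s = (\<Sum>l<e. C l r * C l s)"
  using assms
proof (induction e arbitrary: a)
  case 0
  then show ?case by simp
next
  case (Suc e)
  define t where "t = a e e"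
  have sym: "a e r = a r e" if "r < e" for r
    using Suc.prems(1)[of e r] that by simp
  have Q: "0 \<le> (\<Sum>r<e. \<Sum>s<e. v r * v s * a r s) + 2 * x * (\<Sum>r<e. v r * a r e) + x\<^sup>2 * t" for v x
  proof -
    have "(\<Sum>s<e. x * v s * a e s) = x * (\<Sum>r<e. v r * a r e)"
      by (simp add: sum_distrib_left mult.assoc sym)
    moreover have "(\<Sum>s<e. v s * x * a s e) = x * (\<Sum>r<e. v r * a r e)"
      by (simp add: sum_distrib_left mult_ac)
    ultimately show ?thesis
      using Suc.prems(2)[of "v(e := x)"]
      by (simp add: sum.distrib t_def power2_eq_square algebra_simps)
  qed
  have t0: "0 \<le> t" using Q[of "\<lambda>_. 0" 1] by simp
  have t0': "a r e = 0" if "r < e" "t = 0" for r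
  proof (rule ccontr)
    assume ne: "a r e \<noteq> 0"
    define v where "v = (\<lambda>s. if s = r then 1 else 0 :: real)"
    \<comment> \<open>With this \<open>x\<close> the form takes the value -1.\<close>
    define x where "x = - (a r r + 1) / (2 * a r e)"
    have "(\<Sum>j<e. v i * v j * a i j) = (if i = r then a r r else 0)" for i
      using that(1) by (simp add: v_def if_distrib[of "\<lambda>z. z * _"] cong: if_cong)
    then have 1: "(\<Sum>i<e. \<Sum>j<e. v i * v j * a i j) = a r r"
      using that(1) by simp
    have 2: "(\<Sum>i<e. v i * a i e) = a r e"
      using that(1) by (simp add: v_def if_distrib[of "\<lambda>z. z * _"] cong: if_cong)
    have "0 \<le> a r r + 2 * x * a r e"
      using Q[of v x] unfolding 1 2 that(2) by simp
    then show False using ne by (simp add: x_def field_simps)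
  qed
  \<comment> \<open>The Schur complement of the last diagonal entry. If \<open>t = 0\<close>, the
    quotient is 0 and nothing is subtracted.\<close>
  define a' where "a' = (\<lambda>r s. a r s - a r e * a s e / t)"
  have psd': "0 \<le> (\<Sum>r<e. \<Sum>s<e. v r * v s * a' r s)" for v
  proof -
    define S where "S = (\<Sum>r<e. v r * a r e)"
    have "(\<Sum>r<e. \<Sum>s<e. v r * v s * a' r s) = (\<Sum>r<e. \<Sum>s<e. v r * v s * a r s) - S * S / t"
      unfolding S_def sum_product sum_divide_distrib
      by (simp add: a'_def sum_subtractf[symmetric] algebra_simps)
    \<comment> \<open>For \<open>t > 0\<close> the last variable is put to its minimising value
      \<open>- S / t\<close>.\<close>
    also have "\<dots> = (\<Sum>r<e. \<Sum>s<e. v r * v s * a r s) + 2 * (- S / t) * S + (- S / t)\<^sup>2 * t"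
      by (cases "t = 0") (simp_all add: power2_eq_square field_simps)
    finally show ?thesis using Q[of v "- S / t"] by (simp add: S_def)
  qed
  obtain C where C: "\<And>r s. r < e \<Longrightarrow> s < e \<Longrightarrow> a' r s = (\<Sum>l<e. C l r * C l s)"
    using Suc.IH[of a', OF _ psd'] Suc.prems(1) unfolding a'_def by (auto simp: mult.commute)
  define C' where "C' = (\<lambda>l r. if l = e then a r e / sqrt t else if r = e then 0 else C l r)"
  have "a r s = (\<Sum>l<Suc e. C' l r * C' l s)" if "r < Suc e" "s < Suc e" for r s
  proof -
    have last: "C' e r * C' e s = a r e * a s e / t"
      using t0 by (simp add: C'_def flip: real_sqrt_mult)
    consider "r < e" "s < e" | "r = e \<or> s = e" using \<open>r < Suc e\<close> \<open>s < Suc e\<close> by (auto simp: less_Suc_eq)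
    then show ?thesis
    proof cases
      case 1
      then have "(\<Sum>l<e. C' l r * C' l s) = a' r s"
        using C by (simp add: C'_def)
      then show ?thesis by (simp add: last a'_def)
    next
      case 2
      then have "(\<Sum>l<e. C' l r * C' l s) = 0"
        by (intro sum.neutral) (auto simp: C'_def)
      then show ?thesis
        using 2 that sym t0' last unfolding t_def by (cases "a e e = 0") (auto simp: less_Suc_eq)
    qed
  qed
  then show ?case by blast
qed

text \<open>The rows \<open>u n\<close> live in a space of dimension at most \<open>card K\<close>,
  so finitely many span them all; the proof is Gaussian elimination on the columns. Since
  \<open>c\<close> does not depend on \<open>k\<close>, the same relations hold for every linear
  combination of the columns.\<close>

lemma finite_spanning_indices:
  fixes u :: "'i \<Rightarrow> 'k \<Rightarrow> real"
  assumes "finite K"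
  shows "\<exists>P c. finite P \<and> (\<forall>n. \<forall>k\<in>K. u n k = (\<Sum>m\<in>P. c n m * u m k))"
  using assms
proof (induction K arbitrary: u rule: finite_induct)
  case empty
  show ?case by auto
next
  case (insert r K)
  show ?case
  proof (cases "\<forall>n. u n r = 0")
    case True
    with insert.IH[of u] show ?thesis by auto
  next
    case False
    then obtain n1 where n1: "u n1 r \<noteq> 0" by blast
    \<comment> \<open>Row \<open>n1\<close> is the pivot that clears column
      \<open>r\<close>.\<close>
    define u' where "u' = (\<lambda>n k. u n k - u n r / u n1 r * u n1 k)"
    obtain P c where P: "finite P" and c: "\<And>n k. k \<in> K \<Longrightarrow> u' n k = (\<Sum>m\<in>P. c n m * u' m k)"
      using insert.IH[of u'] by blast
    have "u' n r = 0" for n using n1 by (simp add: u'_def)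
    then have c': "u' n k = (\<Sum>m\<in>P. c n m * u' m k)" if "k \<in> insert r K" for n k
      using c that by auto
    define B where "B = (\<lambda>n. u n r / u n1 r - (\<Sum>m\<in>P. c n m * (u m r / u n1 r)))"
    \<comment> \<open>The pivot may already lie in \<open>P\<close>, so its weight
      \<open>B n\<close> is added to the old coefficient instead of replacing it.\<close>
    define c'' where "c'' = (\<lambda>n m. (if m \<in> P then c n m else 0) + (if m = n1 then B n else 0))"
    have "u n k = (\<Sum>m\<in>insert n1 P. c'' n m * u m k)" if "k \<in> insert r K" for n k
    proof -
      have "u n k = u n r / u n1 r * u n1 k + (\<Sum>m\<in>P. c n m * (u m k - u m r / u n1 r * u n1 k))"
        using c'[OF that, of n] by (simp add: u'_def)
      also have "\<dots> = (\<Sum>m\<in>P. c n m * u m k) + B n * u n1 k"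
        by (simp add: B_def algebra_simps sum_subtractf sum_distrib_left sum_distrib_right)
      also have "(\<Sum>m\<in>P. c n m * u m k) = (\<Sum>m\<in>insert n1 P. (if m \<in> P then c n m * u m k else 0))"
        using P by (intro sum.mono_neutral_cong_left) auto
      also have "B n * u n1 k = (\<Sum>m\<in>insert n1 P. (if m = n1 then B n * u m k else 0))"
        using P by simp
      also have "(\<Sum>m\<in>insert n1 P. (if m \<in> P then c n m * u m k else 0)) + \<dots>
          = (\<Sum>m\<in>insert n1 P. c'' n m * u m k)"
        unfolding sum.distrib[symmetric] by (intro sum.cong) (auto simp: c''_def algebra_simps)
      finally show ?thesis .
    qed
    then show ?thesis using P by (intro exI[of _ "insert n1 P"] exI[of _ c'']) blast
  qed
qed

text \<open>On \<open>I\<close> diagonal dominance leaves at least half of V, the sum of squares of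
  \<open>g\<close> over \<open>I\<close>. The block outside \<open>I\<close> is zero, and each of
  the two mixed blocks costs at most V/4 because \<open>g\<close> is small outside
  \<open>I\<close>.\<close>

lemma quadratic_form_nonneg:
  fixes w :: "'a \<Rightarrow> 'a \<Rightarrow> real" and g :: "'a \<Rightarrow> real"
  assumes J: "finite J" and IJ: "I \<subseteq> J" and R: "0 < R" "2 * real (card I) \<le> R"
    and diag: "\<And>\<alpha>. \<alpha> \<in> I \<Longrightarrow> 1 \<le> w \<alpha> \<alpha>"
    and off: "\<And>\<alpha> \<beta>. \<alpha> \<in> I \<Longrightarrow> \<beta> \<in> I \<Longrightarrow> \<alpha> \<noteq> \<beta> \<Longrightarrow>
      2 * R * \<bar>w \<alpha> \<beta> * g \<alpha> * g \<beta>\<bar> \<le> w \<alpha> \<alpha> * (g \<alpha>)\<^sup>2 + w \<beta> \<beta> * (g \<beta>)\<^sup>2"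
    and vanish: "\<And>\<alpha> \<beta>. \<alpha> \<in> J - I \<Longrightarrow> \<beta> \<in> J - I \<Longrightarrow> w \<alpha> \<beta> = 0"
    and L: "\<And>\<alpha> \<beta>. \<alpha> \<in> J \<Longrightarrow> \<beta> \<in> J \<Longrightarrow> \<bar>w \<alpha> \<beta>\<bar> \<le> L" "0 \<le> L"
    and small: "\<And>\<beta>. \<beta> \<in> J - I \<Longrightarrow> \<bar>g \<beta>\<bar> \<le> \<eta> * (\<Sum>\<alpha>\<in>I. \<bar>g \<alpha>\<bar>)" "0 \<le> \<eta>"
    and \<eta>: "4 * L * real (card J) * \<eta> * real (card I) \<le> 1"
  shows "0 \<le> (\<Sum>\<alpha>\<in>J. \<Sum>\<beta>\<in>J. w \<alpha> \<beta> * g \<alpha> * g \<beta>)"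
proof -
  have I: "finite I" using J IJ finite_subset by blast
  define s where "s = (\<Sum>\<alpha>\<in>I. \<bar>g \<alpha>\<bar>)"
  define V where "V = (\<Sum>\<alpha>\<in>I. (g \<alpha>)\<^sup>2)"
  define U where "U = (\<Sum>\<alpha>\<in>I. w \<alpha> \<alpha> * (g \<alpha>)\<^sup>2)"
  define t where "t = (\<lambda>\<alpha> \<beta>. w \<alpha> \<beta> * g \<alpha> * g \<beta>)"
  have VU: "V \<le> U" unfolding V_def U_def
    using diag by (intro sum_mono) (simp add: mult_le_cancel_right1)
  have V0: "0 \<le> V" unfolding V_def by (simp add: sum_nonneg)
  have s0: "0 \<le> s" unfolding s_def by (simp add: sum_nonneg)
  have sV: "s\<^sup>2 \<le> card I * V"
    using sum_squared_le_sum_of_squares[of "\<lambda>\<alpha>. \<bar>g \<alpha>\<bar>" I] unfolding s_def V_def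
    by (simp add: mult.commute)
  have main: "V / 2 \<le> (\<Sum>\<alpha>\<in>I. \<Sum>\<beta>\<in>I. t \<alpha> \<beta>)"
  proof -
    \<comment> \<open>The diagonal is charged the same deduction as the other entries, so that the
      deductions add up uniformly to \<open>card I / R\<close> times \<open>U\<close>.\<close>
    have lower: "(if \<beta> = \<alpha> then w \<alpha> \<alpha> * (g \<alpha>)\<^sup>2 else 0) - (w \<alpha> \<alpha> * (g \<alpha>)\<^sup>2 + w \<beta> \<beta> * (g \<beta>)\<^sup>2) / (2 * R) \<le> t \<alpha> \<beta>"
      if "\<alpha> \<in> I" "\<beta> \<in> I" for \<alpha> \<beta>
    proof (cases "\<alpha> = \<beta>")
      case True
      have "0 \<le> w \<alpha> \<alpha> * (g \<alpha>)\<^sup>2" using diag[OF that(1)] by simp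
      then have "0 \<le> (w \<alpha> \<alpha> * (g \<alpha>)\<^sup>2 + w \<alpha> \<alpha> * (g \<alpha>)\<^sup>2) / (2 * R)"
        using R by (intro divide_nonneg_pos) auto
      then show ?thesis using True by (simp add: t_def power2_eq_square mult_ac)
    next
      case False
      have "\<bar>t \<alpha> \<beta>\<bar> \<le> (w \<alpha> \<alpha> * (g \<alpha>)\<^sup>2 + w \<beta> \<beta> * (g \<beta>)\<^sup>2) / (2 * R)"
        using off[OF that False] R by (simp add: t_def field_simps)
      then show ?thesis using False by auto
    qed
    define f where "f = (\<lambda>\<alpha>. w \<alpha> \<alpha> * (g \<alpha>)\<^sup>2)"
    have "(\<Sum>\<alpha>\<in>I. \<Sum>\<beta>\<in>I. (if \<beta> = \<alpha> then f \<alpha> else 0)) = U"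
      using I by (simp add: U_def f_def)
    moreover have "(\<Sum>\<alpha>\<in>I. \<Sum>\<beta>\<in>I. f \<alpha> + f \<beta>) = 2 * real (card I) * U"
      by (simp add: sum.distrib U_def f_def flip: sum_distrib_left)
    then have "(\<Sum>\<alpha>\<in>I. \<Sum>\<beta>\<in>I. (f \<alpha> + f \<beta>) / (2 * R)) = (card I / R) * U"
      by (simp add: sum_divide_distrib[symmetric])
    ultimately have "U - (card I / R) * U = (\<Sum>\<alpha>\<in>I. \<Sum>\<beta>\<in>I. (if \<beta> = \<alpha> then w \<alpha> \<alpha> * (g \<alpha>)\<^sup>2 else 0)
        - (w \<alpha> \<alpha> * (g \<alpha>)\<^sup>2 + w \<beta> \<beta> * (g \<beta>)\<^sup>2) / (2 * R))"
      by (simp only: sum_subtractf f_def)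
    also have "\<dots> \<le> (\<Sum>\<alpha>\<in>I. \<Sum>\<beta>\<in>I. t \<alpha> \<beta>)"
      by (intro sum_mono lower)
    finally have "U - (card I / R) * U \<le> (\<Sum>\<alpha>\<in>I. \<Sum>\<beta>\<in>I. t \<alpha> \<beta>)" .
    moreover have "(card I / R) * U \<le> 1 / 2 * U"
      using VU V0 R by (intro mult_right_mono) (auto simp: field_simps)
    ultimately show ?thesis using VU by linarith
  qed
  have cross: "\<bar>t \<alpha> \<beta>\<bar> \<le> L * \<bar>g \<alpha>\<bar> * (\<eta> * s)" "\<bar>t \<beta> \<alpha>\<bar> \<le> L * \<bar>g \<alpha>\<bar> * (\<eta> * s)"
    if "\<alpha> \<in> I" "\<beta> \<in> J - I" for \<alpha> \<beta>
  proof -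
    have "\<bar>w \<alpha> \<beta>\<bar> * (\<bar>g \<alpha>\<bar> * \<bar>g \<beta>\<bar>) \<le> L * (\<bar>g \<alpha>\<bar> * (\<eta> * s))" "\<bar>w \<beta> \<alpha>\<bar> * (\<bar>g \<alpha>\<bar> * \<bar>g \<beta>\<bar>) \<le> L * (\<bar>g \<alpha>\<bar> * (\<eta> * s))"
      using that IJ small(1)[OF that(2)] L unfolding s_def by (intro mult_mono; auto)+
    then show "\<bar>t \<alpha> \<beta>\<bar> \<le> L * \<bar>g \<alpha>\<bar> * (\<eta> * s)" "\<bar>t \<beta> \<alpha>\<bar> \<le> L * \<bar>g \<alpha>\<bar> * (\<eta> * s)"
      by (simp_all add: t_def abs_mult mult_ac)
  qed
  have crosses: "(\<Sum>\<alpha>\<in>I. \<Sum>\<beta>\<in>J - I. L * \<bar>g \<alpha>\<bar> * (\<eta> * s)) \<le> V / 4"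
  proof -
    have "(\<Sum>\<alpha>\<in>I. \<Sum>\<beta>\<in>J - I. L * \<bar>g \<alpha>\<bar> * (\<eta> * s)) = card (J - I) * (L * \<eta> * s\<^sup>2)"
      by (simp add: s_def power2_eq_square sum_distrib_left sum_distrib_right mult_ac)
    also have "\<dots> \<le> card J * (L * \<eta> * (card I * V))"
      using J L(2) small(2) sV by (intro mult_mono mult_left_mono) (auto intro: card_mono)
    also have "\<dots> = (4 * L * real (card J) * \<eta> * real (card I)) * (V / 4)" by simp
    also have "\<dots> \<le> 1 * (V / 4)"
      using \<eta> V0 by (intro mult_right_mono) auto
    finally show ?thesis by simp
  qed
  have c1: "- (V / 4) \<le> (\<Sum>\<alpha>\<in>I. \<Sum>\<beta>\<in>J - I. t \<alpha> \<beta>)"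
  proof -
    have "\<bar>\<Sum>\<alpha>\<in>I. \<Sum>\<beta>\<in>J - I. t \<alpha> \<beta>\<bar> \<le> (\<Sum>\<alpha>\<in>I. \<Sum>\<beta>\<in>J - I. L * \<bar>g \<alpha>\<bar> * (\<eta> * s))"
      by (intro sum_norm_le[where 'a = real, unfolded real_norm_def] cross)
    then show ?thesis using crosses by linarith
  qed
  have c2: "- (V / 4) \<le> (\<Sum>\<alpha>\<in>J - I. \<Sum>\<beta>\<in>I. t \<alpha> \<beta>)"
  proof -
    have "\<bar>\<Sum>\<beta>\<in>I. \<Sum>\<alpha>\<in>J - I. t \<alpha> \<beta>\<bar> \<le> (\<Sum>\<alpha>\<in>I. \<Sum>\<beta>\<in>J - I. L * \<bar>g \<alpha>\<bar> * (\<eta> * s))"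
      by (intro sum_norm_le[where 'a = real, unfolded real_norm_def] cross)
    then show ?thesis using crosses sum.swap[of t I "J - I"] by linarith
  qed
  have c3: "(\<Sum>\<alpha>\<in>J - I. \<Sum>\<beta>\<in>J - I. t \<alpha> \<beta>) = 0"
    using vanish by (simp add: t_def)
  have split: "sum f J = sum f (J - I) + sum f I" for f :: "'a \<Rightarrow> real"
    by (rule sum.subset_diff[OF IJ J])
  have "(\<Sum>\<alpha>\<in>J. \<Sum>\<beta>\<in>J. t \<alpha> \<beta>) = (\<Sum>\<alpha>\<in>J - I. \<Sum>\<beta>\<in>J - I. t \<alpha> \<beta>) + (\<Sum>\<alpha>\<in>J - I. \<Sum>\<beta>\<in>I. t \<alpha> \<beta>)
      + ((\<Sum>\<alpha>\<in>I. \<Sum>\<beta>\<in>J - I. t \<alpha> \<beta>) + (\<Sum>\<alpha>\<in>I. \<Sum>\<beta>\<in>I. t \<alpha> \<beta>))"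
    unfolding split sum.distrib by simp
  then show ?thesis using main c1 c2 c3 unfolding t_def by linarith
qed

section \<open>Pseudo-moments\<close>

text \<open>The numbers \<open>R ^ height i j\<close>, put at the exponents \<open>(2 i, 2 j)\<close>, are the moments of a
  functional that is positive on squares of bounded degree if \<open>R\<close> is large, because a strictly
  midpoint convex height makes the moment matrix diagonally dominant.  The height is a positive
  definite quadratic, centred at \<open>(1, 1)\<close> and symmetric in the triangle \<open>(0, 0)\<close>, \<open>(2, 1)\<close>,
  \<open>(1, 2)\<close>, raised enough at the centroid to make Motzkin's polynomial negative.\<close>

definition bump :: "int \<Rightarrow> int \<Rightarrow> int" where
  "bump i j = (if (i, j) \<in> {(0, 0), (2, 1), (1, 2)} then 0 else if (i, j) = (1, 1) then 6 else 4)"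

definition height :: "int \<Rightarrow> int \<Rightarrow> int" where
  "height i j = 5 * (i * i - i * j + j * j - i - j) + bump i j"

section \<open>Convexity of the height on the hexagonal lattice\<close>

text \<open>This is the norm form of the hexagonal lattice: below 2 there are only zero and the six
  minimal vectors. Completing the square in either variable bounds the other.\<close>

lemma hexagonal_form_le_1:
  fixes a b :: int
  assumes "a * a - a * b + b * b < 2"
  shows "(a, b) \<in> {(0, 0), (1, 0), (-1, 0), (0, 1), (0, -1), (1, 1), (-1, -1)}"
proof -
  define E where "E = a * a - a * b + b * b"
  have "4 * E = (2 * a - b)\<^sup>2 + 3 * (b * b)" "4 * E = (2 * b - a)\<^sup>2 + 3 * (a * a)"
    by (simp_all add: E_def power2_eq_square algebra_simps)
  moreover have "0 \<le> (2 * a - b)\<^sup>2" "0 \<le> (2 * b - a)\<^sup>2" "E < 2"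
    using assms by (simp_all add: E_def)
  ultimately have "3 * (b * b) < 8" "3 * (a * a) < 8" by linarith+
  moreover have "\<bar>x\<bar> < 2" if "3 * (x * x) < 8" for x :: int
  proof (rule ccontr)
    assume "\<not> \<bar>x\<bar> < 2"
    then have "2 * 2 \<le> \<bar>x\<bar> * \<bar>x\<bar>" by (intro mult_mono) auto
    then show False using that by simp
  qed
  ultimately have "a = -1 \<or> a = 0 \<or> a = 1" "b = -1 \<or> b = 0 \<or> b = 1" by fastforce+
  then show ?thesis using assms by auto
qed

lemma hexagonal_form_pos:
  fixes a b :: int
  assumes "(a, b) \<noteq> (0, 0)"
  shows "1 \<le> a * a - a * b + b * b"
proof (cases "a * a - a * b + b * b < 2")
  case True
  then show ?thesis using hexagonal_form_le_1[OF True] assms by auto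
qed simp

text \<open>The quadratic part is 5 times the hexagonal form centred at (1, 1), minus 5.
  Nonnegativity ensures that \<open>nat\<close> in \<open>moment_weight\<close> loses
  nothing.\<close>

lemma height_nonneg: "0 \<le> height i j"
proof (cases "(i - 1, j - 1) = (0, 0)")
  case False
  then have "1 \<le> (i - 1) * (i - 1) - (i - 1) * (j - 1) + (j - 1) * (j - 1)"
    by (rule hexagonal_form_pos)
  then have "0 \<le> i * i - i * j + j * j - i - j" by (simp add: algebra_simps)
  moreover have "0 \<le> bump i j" by (simp add: bump_def)
  ultimately show ?thesis by (simp add: height_def)
qed (simp add: height_def bump_def)

text \<open>Strict midpoint convexity on the lattice; it survives the bump at \<open>(1, 1)\<close> because that
  point is not the midpoint of two of the points \<open>(0, 0)\<close>, \<open>(2, 1)\<close>, \<open>(1, 2)\<close>, only their centroid.\<close>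

lemma height_midpoint:
  assumes "(a, b) \<noteq> (0, 0)"
  shows "2 * height i j + 2 \<le> height (i + a) (j + b) + height (i - a) (j - b)"
proof -
  define q where "q = a * a - a * b + b * b"
  have q1: "1 \<le> q" unfolding q_def using assms by (rule hexagonal_form_pos)
  have eq: "height (i + a) (j + b) + height (i - a) (j - b) - 2 * height i j
      = 10 * q + bump (i + a) (j + b) + bump (i - a) (j - b) - 2 * bump i j"
    by (simp add: height_def q_def algebra_simps)
  have nn: "0 \<le> bump x y" for x y by (simp add: bump_def)
  show ?thesis
  \<comment> \<open>Away from the centre the bump costs at most 8, against a gain of
    \<open>10 * q\<close>. At the centre it costs 12, which is critical only for a minimal step;
    then one of the two endpoints has bump 4, and 10 + 4 - 12 is exactly 2.\<close>
  proof (cases "i = 1 \<and> j = 1 \<and> q < 2")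
    case True
    then have "(a, b) \<in> {(0, 0), (1, 0), (-1, 0), (0, 1), (0, -1), (1, 1), (-1, -1)}"
      unfolding q_def by (intro hexagonal_form_le_1) simp
    then have "4 \<le> bump (1 + a) (1 + b) + bump (1 - a) (1 - b)"
      using assms by (auto simp: bump_def)
    then show ?thesis using eq True q1 by (simp add: bump_def)
  next
    case False
    have "bump i j \<le> 4 \<or> i = 1 \<and> j = 1 \<and> bump i j = 6" by (auto simp: bump_def)
    then show ?thesis
      using eq False q1 nn[of "i + a" "j + b"] nn[of "i - a" "j - b"] by linarith
  qed
qed

definition moment_weight :: "real \<Rightarrow> nat \<Rightarrow> nat \<Rightarrow> real" where
  "moment_weight R p q =
     (if even p \<and> even q then R ^ nat (height (int p div 2) (int q div 2)) else 0)"

lemma moment_weight_diag: "moment_weight R (p + p) (q + q) = R ^ nat (height (int p) (int q))"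
  by (simp add: moment_weight_def flip: mult_2)

text \<open>The inequality of the arithmetic and geometric means; the surplus 2 in
  \<open>height_midpoint\<close> pays for the factor \<open>R\<close> on the left after
  squaring.\<close>

lemma moment_weight_off_diag:
  assumes R: "1 \<le> R" and ne: "(p, q) \<noteq> (p', q')"
  shows "2 * R * \<bar>moment_weight R (p + p') (q + q') * x * y\<bar>
    \<le> moment_weight R (p + p) (q + q) * x\<^sup>2 + moment_weight R (p' + p') (q' + q') * y\<^sup>2"
proof (cases "even (p + p') \<and> even (q + q')")
  case False
  then show ?thesis using R by (auto simp: moment_weight_def)
next
  case True
  define i j where "i = int (p + p') div 2" and "j = int (q + q') div 2"
  define a b where "a = int p - i" and "b = int q - j"
  have i: "int (p + p') = 2 * i" and j: "int (q + q') = 2 * j"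
    using True unfolding i_def j_def by (simp_all add: even_of_nat_iff flip: of_nat_add)
  have eqs: "int p = i + a" "int q = j + b" "int p' = i - a" "int q' = j - b"
    using i j by (simp_all add: a_def b_def)
  have "(a, b) \<noteq> (0, 0)" using ne eqs by auto
  then have gap: "2 * height i j + 2 \<le> height (int p) (int q) + height (int p') (int q')"
    unfolding eqs by (rule height_midpoint)
  define h h1 h2 where "h = nat (height i j)" and "h1 = nat (height (int p) (int q))"
    and "h2 = nat (height (int p') (int q'))"
  have gap': "2 * h + 2 \<le> h1 + h2"
    using gap height_nonneg[of i j] height_nonneg[of "int p" "int q"] height_nonneg[of "int p'" "int q'"]
    unfolding h_def h1_def h2_def by linarith
  have w: "moment_weight R (p + p') (q + q') = R ^ h"
    using True by (simp add: moment_weight_def h_def i_def j_def)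
  define A B where "A = R ^ h1 * x\<^sup>2" and "B = R ^ h2 * y\<^sup>2"
  have AB: "0 \<le> A" "0 \<le> B" using R by (simp_all add: A_def B_def)
  have "(2 * R * \<bar>R ^ h * x * y\<bar>)\<^sup>2 = 4 * (R ^ (2 * h + 2) * (x\<^sup>2 * y\<^sup>2))"
    by (simp only: power_mult_distrib power2_abs power_add power_even_eq) simp
  also have "\<dots> \<le> 4 * (R ^ (h1 + h2) * (x\<^sup>2 * y\<^sup>2))"
    using R gap' by (intro mult_left_mono mult_right_mono power_increasing) auto
  also have "\<dots> = 4 * (A * B)" by (simp add: A_def B_def power_add)
  also have "\<dots> \<le> (A + B)\<^sup>2"
    using sum_squares_bound[of A B] by (simp add: power2_sum)
  finally have "2 * R * \<bar>R ^ h * x * y\<bar> \<le> A + B"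
    by (rule power2_le_imp_le) (use AB in simp)
  then show ?thesis
    unfolding w moment_weight_diag A_def B_def h1_def h2_def .
qed

section \<open>Moment functionals on power series in two variables\<close>

definition coeff2 :: "real fps fps \<Rightarrow> nat \<times> nat \<Rightarrow> real" where
  "coeff2 F \<alpha> = fps_nth (fps_nth F (snd \<alpha>)) (fst \<alpha>)"

definition moment_functional :: "(nat \<Rightarrow> nat \<Rightarrow> real) \<Rightarrow> nat \<Rightarrow> real fps fps \<Rightarrow> real" where
  "moment_functional W N F = (\<Sum>p\<le>N. \<Sum>q\<le>N. W p q * coeff2 F (p, q))"

lemma moment_functional_add:
  "moment_functional W N (F + G) = moment_functional W N F + moment_functional W N G"
  by (simp add: moment_functional_def coeff2_def algebra_simps sum.distrib)

lemma moment_functional_scale: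
  "moment_functional W N (fps_const2 c * F) = c * moment_functional W N F"
  by (simp add: moment_functional_def coeff2_def sum_distrib_left mult_ac)

lemma moment_functional_monomial:
  assumes "a \<le> N" "b \<le> N"
  shows "moment_functional W N (fps_const fps_X ^ a * fps_X ^ b) = W a b"
proof -
  have "coeff2 (fps_const fps_X ^ a * fps_X ^ b) (p, q) = (if q = b then if p = a then 1 else 0 else 0)" for p q
    by (simp add: coeff2_def fps_X_power_nth)
  then have "moment_functional W N (fps_const fps_X ^ a * fps_X ^ b)
      = (\<Sum>p\<le>N. \<Sum>q\<le>N. if q = b then if p = a then W p q else 0 else 0)"
    by (simp add: moment_functional_def if_distrib[of "\<lambda>z. _ * z"] cong: if_cong)
  also have "\<dots> = W a b" using assms by simp
  finally show ?thesis .
qed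

text \<open>Passing from the triangle \<open>i + j \<le> N\<close> to the square adds only terms on
  which \<open>f\<close> vanishes.\<close>

lemma sum_antidiagonals:
  fixes f :: "nat \<Rightarrow> real"
  assumes "\<And>n. n > N \<Longrightarrow> f n = 0"
  shows "(\<Sum>n\<le>N. f n * (\<Sum>i\<le>n. g i (n - i))) = (\<Sum>i\<le>N. \<Sum>j\<le>N. f (i + j) * g i j)"
proof -
  have "(\<Sum>n\<le>N. f n * (\<Sum>i\<le>n. g i (n - i))) = (\<Sum>n\<le>N. \<Sum>i\<le>n. f (i + (n - i)) * g i (n - i))"
    by (simp add: sum_distrib_left)
  also have "\<dots> = (\<Sum>(i, j)\<in>{(i, j). i + j \<le> N}. f (i + j) * g i j)"
    by (rule sum.triangle_reindex_eq[symmetric])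
  also have "\<dots> = (\<Sum>(i, j)\<in>{..N} \<times> {..N}. f (i + j) * g i j)"
    using assms by (intro sum.mono_neutral_left) (auto, meson linorder_not_le)
  finally show ?thesis by (simp add: sum.cartesian_product)
qed

text \<open>Reindexing the two nested Cauchy products exhibits the bilinear form of the moment
  matrix.\<close>

lemma moment_functional_mult:
  assumes "\<And>p q. p > N \<or> q > N \<Longrightarrow> W p q = 0"
  shows "moment_functional W N (F * G) = (\<Sum>\<alpha>\<in>{..N} \<times> {..N}. \<Sum>\<beta>\<in>{..N} \<times> {..N}.
    W (fst \<alpha> + fst \<beta>) (snd \<alpha> + snd \<beta>) * coeff2 F \<alpha> * coeff2 G \<beta>)"
proof -
  define t where "t = (\<lambda>p p' q q'. W (p + p') (q + q') * (coeff2 F (p, q) * coeff2 G (p', q')))"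
  have "coeff2 (F * G) (p, q) = (\<Sum>b\<le>q. \<Sum>a\<le>p. coeff2 F (a, b) * coeff2 G (p - a, q - b))" for p q
    by (simp add: coeff2_def fps_mult_nth fps_sum_nth atMost_atLeast0)
  then have "moment_functional W N (F * G)
      = (\<Sum>p\<le>N. \<Sum>q\<le>N. W p q * (\<Sum>b\<le>q. \<Sum>a\<le>p. coeff2 F (a, b) * coeff2 G (p - a, q - b)))"
    by (simp add: moment_functional_def)
  also have "\<dots> = (\<Sum>p\<le>N. \<Sum>b\<le>N. \<Sum>b'\<le>N. W p (b + b') * (\<Sum>a\<le>p. coeff2 F (a, b) * coeff2 G (p - a, b')))"
    using assms by (intro sum.cong sum_antidiagonals) auto
  also have "\<dots> = (\<Sum>b\<le>N. \<Sum>p\<le>N. \<Sum>b'\<le>N. W p (b + b') * (\<Sum>a\<le>p. coeff2 F (a, b) * coeff2 G (p - a, b')))"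
    by (rule sum.swap)
  also have "\<dots> = (\<Sum>b\<le>N. \<Sum>b'\<le>N. \<Sum>p\<le>N. W p (b + b') * (\<Sum>a\<le>p. coeff2 F (a, b) * coeff2 G (p - a, b')))"
    by (rule sum.cong[OF refl], rule sum.swap)
  also have "\<dots> = (\<Sum>b\<le>N. \<Sum>b'\<le>N. \<Sum>a\<le>N. \<Sum>a'\<le>N. t a a' b b')"
    unfolding t_def using assms by (intro sum.cong sum_antidiagonals) auto
  also have "\<dots> = (\<Sum>b\<le>N. \<Sum>a\<le>N. \<Sum>b'\<le>N. \<Sum>a'\<le>N. t a a' b b')"
    by (rule sum.cong[OF refl], rule sum.swap)
  also have "\<dots> = (\<Sum>a\<le>N. \<Sum>b\<le>N. \<Sum>b'\<le>N. \<Sum>a'\<le>N. t a a' b b')"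
    by (rule sum.swap)
  also have "\<dots> = (\<Sum>a\<le>N. \<Sum>b\<le>N. \<Sum>a'\<le>N. \<Sum>b'\<le>N. t a a' b b')"
    by (rule sum.cong[OF refl], rule sum.cong[OF refl], rule sum.swap)
  finally show ?thesis
    by (simp add: t_def sum.cartesian_product' mult.assoc)
qed

text \<open>The quartic of Choi and Lam; for \<open>z = x * y\<close> it is Motzkin's polynomial.\<close>

definition test_poly :: "'a::comm_ring_1 \<Rightarrow> 'a \<Rightarrow> 'a \<Rightarrow> 'a" where
  "test_poly x y z = 1 + x\<^sup>2 * y\<^sup>2 + y\<^sup>2 * z\<^sup>2 + z\<^sup>2 * x\<^sup>2 - 4 * (x * y * z)"

lemma test_poly_scaled_product:
  "test_poly (k * x) (k * y) (k\<^sup>2 * (x * y))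
    = 1 + (k ^ 6 * (x ^ 2 * y ^ 4) + (k ^ 6 * (x ^ 4 * y ^ 2) + (- 3) * (k ^ 4 * (x ^ 2 * y ^ 2))))"
  by (simp add: test_poly_def eval_nat_numeral algebra_simps)

lemma exists_pseudo_moment_functional:
  fixes F :: "'i \<Rightarrow> real fps fps"
  assumes "finite K"
  obtains \<Lambda> :: "real fps fps \<Rightarrow> real" and \<epsilon> :: real where
    "\<epsilon> > 0" "\<And>G H. \<Lambda> (G + H) = \<Lambda> G + \<Lambda> H" "\<And>c G. \<Lambda> (fps_const2 c * G) = c * \<Lambda> G"
    "\<Lambda> 1 = 1"
    "\<And>b. 0 \<le> \<Lambda> ((\<Sum>i\<in>K. fps_const2 (b i) * F i)\<^sup>2)"
    "\<Lambda> (test_poly (fps_const2 (1 / \<epsilon>) * fps_const fps_X) (fps_const2 (1 / \<epsilon>) * fps_X)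
        (fps_const2 (1 / \<epsilon>\<^sup>2) * (fps_const fps_X * fps_X))) < 0"
proof -
  obtain P c where P: "finite P"
    and c: "\<And>n i. i \<in> K \<Longrightarrow> coeff2 (F i) n = (\<Sum>m\<in>P. c n m * coeff2 (F i) m)"
    using finite_spanning_indices[OF assms, of "\<lambda>n i. coeff2 (F i) n"] by blast
  define deg :: "nat \<times> nat \<Rightarrow> nat" where "deg = (\<lambda>\<alpha>. fst \<alpha> + snd \<alpha>)"
  \<comment> \<open>The sum makes \<open>D\<close> bound the degrees of all controlling
    coefficients; the 3 makes \<open>N = 2 * D\<close> reach degree 6, that of Motzkin's
    polynomial.\<close>
  define D where "D = 3 + (\<Sum>\<alpha>\<in>P. deg \<alpha>)"
  define N where "N = 2 * D"
  define J where "J = {..N} \<times> {..N}"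
  define I where "I = {\<alpha>. deg \<alpha> \<le> D}"
  have J: "finite J" by (simp add: J_def)
  have IJ: "I \<subseteq> J" by (auto simp: I_def J_def N_def deg_def)
  have degP: "deg \<alpha> \<le> D" if "\<alpha> \<in> P" for \<alpha>
    using member_le_sum[OF that, of deg] P by (simp add: D_def)
  define R where "R = 2 * real (card I) + 2"
  have R: "1 < R" by (simp add: R_def)
  \<comment> \<open>Cutting off at total degree \<open>2 * D\<close> makes the moment matrix vanish
    on pairs of exponents of degree greater than \<open>D\<close>, while pairs of degree at most
    \<open>D\<close> are untouched.\<close>
  define w where "w = (\<lambda>p q. if p + q \<le> N then moment_weight R p q else 0)"
  define w2 where "w2 = (\<lambda>\<alpha> \<beta>. w (fst \<alpha> + fst \<beta>) (snd \<alpha> + snd \<beta>))"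
  define L where "L = (\<Sum>\<alpha>\<in>J. \<Sum>\<beta>\<in>J. \<bar>w2 \<alpha> \<beta>\<bar>)"
  define B where "B = (\<Sum>\<beta>\<in>J. \<Sum>\<alpha>\<in>P. \<bar>c \<beta> \<alpha>\<bar>)"
  have L0: "0 \<le> L" and B0: "0 \<le> B" by (simp_all add: L_def B_def sum_nonneg)
  have Lw: "\<bar>w2 \<alpha> \<beta>\<bar> \<le> L" if "\<alpha> \<in> J" "\<beta> \<in> J" for \<alpha> \<beta>
  proof -
    have "\<bar>w2 \<alpha> \<beta>\<bar> \<le> (\<Sum>\<beta>\<in>J. \<bar>w2 \<alpha> \<beta>\<bar>)"
      using that J by (intro member_le_sum) auto
    also have "\<dots> \<le> L"
      unfolding L_def using that J by (intro member_le_sum[of \<alpha> J "\<lambda>\<alpha>. \<Sum>\<beta>\<in>J. \<bar>w2 \<alpha> \<beta>\<bar>"]) (auto intro: sum_nonneg)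
    finally show ?thesis .
  qed
  \<comment> \<open>Chosen to meet the last hypothesis of \<open>quadratic_form_nonneg\<close> for
    \<eta> = \<open>\<epsilon> * B\<close>.\<close>
  define \<epsilon> where "\<epsilon> = 1 / (1 + 4 * L * real (card J) * B * real (card I))"
  have den: "0 \<le> 4 * L * real (card J) * B * real (card I)" using L0 B0 by simp
  have \<epsilon>: "0 < \<epsilon>" "\<epsilon> \<le> 1" "4 * L * real (card J) * (\<epsilon> * B) * real (card I) \<le> 1"
    using den unfolding \<epsilon>_def by (simp_all add: field_simps)
  define W where "W = (\<lambda>p q. w p q * \<epsilon> ^ (p + q))"
  define \<Lambda> where "\<Lambda> = moment_functional W N"
  have W0: "W p q = 0" if "p > N \<or> q > N" for p q
    using that by (auto simp: W_def w_def)
  have N6: "6 \<le> N" by (simp add: N_def D_def)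
  have mon: "\<Lambda> (fps_const fps_X ^ a * fps_X ^ b) = W a b" if "a \<le> N" "b \<le> N" for a b
    unfolding \<Lambda>_def using that by (rule moment_functional_monomial)
  have scale: "\<Lambda> (fps_const2 c * G) = c * \<Lambda> G" for c G
    unfolding \<Lambda>_def by (rule moment_functional_scale)
  have add: "\<Lambda> (G + H) = \<Lambda> G + \<Lambda> H" for G H
    unfolding \<Lambda>_def by (rule moment_functional_add)
  have one: "\<Lambda> 1 = 1"
    using mon[of 0 0] by (simp add: W_def w_def moment_weight_def height_def bump_def)
  show ?thesis
  proof
    show "0 < \<epsilon>" by (fact \<epsilon>)
    show "\<Lambda> (G + H) = \<Lambda> G + \<Lambda> H" for G H by (fact add)
    show "\<Lambda> (fps_const2 c * G) = c * \<Lambda> G" for c G by (fact scale)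
    show "\<Lambda> 1 = 1" by (fact one)
  next
    fix b
    define G where "G = (\<Sum>i\<in>K. fps_const2 (b i) * F i)"
    \<comment> \<open>The powers of \<epsilon> in \<open>W\<close> are absorbed into the
      coefficients.\<close>
    define g where "g = (\<lambda>\<alpha>. \<epsilon> ^ deg \<alpha> * coeff2 G \<alpha>)"
    have cG: "coeff2 G \<alpha> = (\<Sum>i\<in>K. b i * coeff2 (F i) \<alpha>)" for \<alpha>
      by (simp add: G_def coeff2_def fps_sum_nth)
    have cG': "coeff2 G \<beta> = (\<Sum>\<alpha>\<in>P. c \<beta> \<alpha> * coeff2 G \<alpha>)" for \<beta>
    proof -
      have "coeff2 G \<beta> = (\<Sum>i\<in>K. b i * (\<Sum>\<alpha>\<in>P. c \<beta> \<alpha> * coeff2 (F i) \<alpha>))"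
        unfolding cG using c by (intro sum.cong) auto
      also have "\<dots> = (\<Sum>\<alpha>\<in>P. c \<beta> \<alpha> * coeff2 G \<alpha>)"
        unfolding cG sum_distrib_left by (subst sum.swap) (simp add: mult_ac)
      finally show ?thesis .
    qed
    have "\<Lambda> (G * G) = (\<Sum>\<alpha>\<in>J. \<Sum>\<beta>\<in>J. W (fst \<alpha> + fst \<beta>) (snd \<alpha> + snd \<beta>) * coeff2 G \<alpha> * coeff2 G \<beta>)"
      unfolding \<Lambda>_def J_def by (rule moment_functional_mult[OF W0])
    also have "\<dots> = (\<Sum>\<alpha>\<in>J. \<Sum>\<beta>\<in>J. w2 \<alpha> \<beta> * g \<alpha> * g \<beta>)"
      by (intro sum.cong refl) (simp add: W_def w2_def g_def deg_def power_add mult_ac)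
    also have "0 \<le> \<dots>"
    proof (rule quadratic_form_nonneg[OF J IJ, where R = R and L = L and \<eta> = "\<epsilon> * B"])
      show "0 < R" "2 * real (card I) \<le> R" by (simp_all add: R_def)
      show "0 \<le> L" "0 \<le> \<epsilon> * B" using L0 B0 \<epsilon> by simp_all
      show "\<bar>w2 \<alpha> \<beta>\<bar> \<le> L" if "\<alpha> \<in> J" "\<beta> \<in> J" for \<alpha> \<beta> using that by (rule Lw)
      show "4 * L * real (card J) * (\<epsilon> * B) * real (card I) \<le> 1" by (fact \<epsilon>)
      have w2_I: "w2 \<alpha> \<beta> = moment_weight R (fst \<alpha> + fst \<beta>) (snd \<alpha> + snd \<beta>)" if "\<alpha> \<in> I" "\<beta> \<in> I" for \<alpha> \<beta>
        using that by (auto simp: w2_def w_def I_def deg_def N_def)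
      show "1 \<le> w2 \<alpha> \<alpha>" if "\<alpha> \<in> I" for \<alpha>
        unfolding w2_I[OF that that] moment_weight_diag using R by simp
      show "2 * R * \<bar>w2 \<alpha> \<beta> * g \<alpha> * g \<beta>\<bar> \<le> w2 \<alpha> \<alpha> * (g \<alpha>)\<^sup>2 + w2 \<beta> \<beta> * (g \<beta>)\<^sup>2"
        if "\<alpha> \<in> I" "\<beta> \<in> I" "\<alpha> \<noteq> \<beta>" for \<alpha> \<beta>
        unfolding w2_I[OF that(1,1)] w2_I[OF that(1,2)] w2_I[OF that(2,2)]
        using R that(3) by (intro moment_weight_off_diag) (auto simp: prod_eq_iff)
      show "w2 \<alpha> \<beta> = 0" if "\<alpha> \<in> J - I" "\<beta> \<in> J - I" for \<alpha> \<beta>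
        using that by (auto simp: w2_def w_def I_def deg_def N_def)
      show "\<bar>g \<beta>\<bar> \<le> \<epsilon> * B * (\<Sum>\<alpha>\<in>I. \<bar>g \<alpha>\<bar>)" if \<beta>: "\<beta> \<in> J - I" for \<beta>
      proof -
        define s where "s = (\<Sum>\<alpha>\<in>I. \<bar>g \<alpha>\<bar>)"
        have s0: "0 \<le> s" by (simp add: s_def sum_nonneg)
        have bd: "\<epsilon> ^ deg \<beta> * \<bar>coeff2 G \<alpha>\<bar> \<le> \<epsilon> * s" if "\<alpha> \<in> P" for \<alpha>
        proof -
          \<comment> \<open>A coefficient outside \<open>I\<close> has larger degree than those
            controlling it, which yields the spare factor \<epsilon>.\<close>
          have "deg \<alpha> + 1 \<le> deg \<beta>" using degP[OF that] \<beta> by (simp add: I_def)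
          then have "\<epsilon> ^ deg \<beta> \<le> \<epsilon> ^ (deg \<alpha> + 1)"
            using \<epsilon> by (intro power_decreasing) auto
          then have "\<epsilon> ^ deg \<beta> * \<bar>coeff2 G \<alpha>\<bar> \<le> \<epsilon> ^ (deg \<alpha> + 1) * \<bar>coeff2 G \<alpha>\<bar>"
            by (intro mult_right_mono) auto
          also have "\<dots> = \<epsilon> * \<bar>g \<alpha>\<bar>" using \<epsilon> by (simp add: g_def abs_mult)
          also have "\<bar>g \<alpha>\<bar> \<le> s"
            unfolding s_def using degP[OF that] finite_subset[OF IJ J]
            by (intro member_le_sum[of \<alpha> I "\<lambda>\<alpha>. \<bar>g \<alpha>\<bar>"]) (auto simp: I_def)
          finally show ?thesis using \<epsilon> by simp
        qed
        have "\<bar>g \<beta>\<bar> = \<bar>\<Sum>\<alpha>\<in>P. c \<beta> \<alpha> * (\<epsilon> ^ deg \<beta> * coeff2 G \<alpha>)\<bar>"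
          by (simp add: g_def cG'[of \<beta>] sum_distrib_left mult_ac)
        also have "\<dots> \<le> (\<Sum>\<alpha>\<in>P. \<bar>c \<beta> \<alpha>\<bar> * (\<epsilon> * s))"
        proof (rule order_trans[OF sum_abs], rule sum_mono)
          fix \<alpha> assume "\<alpha> \<in> P"
          then show "\<bar>c \<beta> \<alpha> * (\<epsilon> ^ deg \<beta> * coeff2 G \<alpha>)\<bar> \<le> \<bar>c \<beta> \<alpha>\<bar> * (\<epsilon> * s)"
            using mult_left_mono[OF bd, of \<alpha> "\<bar>c \<beta> \<alpha>\<bar>"] \<epsilon> by (simp add: abs_mult)
        qed
        also have "\<dots> = (\<Sum>\<alpha>\<in>P. \<bar>c \<beta> \<alpha>\<bar>) * (\<epsilon> * s)" by (simp add: sum_distrib_right)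
        also have "\<dots> \<le> B * (\<epsilon> * s)"
          unfolding B_def using \<beta> J s0 \<epsilon>
          by (intro mult_right_mono member_le_sum[of \<beta> J "\<lambda>\<beta>. \<Sum>\<alpha>\<in>P. \<bar>c \<beta> \<alpha>\<bar>"])
             (auto intro: sum_nonneg)
        finally show ?thesis by (simp add: s_def mult_ac)
      qed
    qed
    finally show "0 \<le> \<Lambda> ((\<Sum>i\<in>K. fps_const2 (b i) * F i)\<^sup>2)"
      by (simp add: G_def power2_eq_square)
  next
    let ?X = "fps_const fps_X :: real fps fps" and ?Y = "fps_X :: real fps fps"
    define k where "k = fps_const2 (1 / \<epsilon>)"
    have k2: "fps_const2 (1 / \<epsilon>\<^sup>2) = k\<^sup>2" by (simp add: k_def power_divide)
    have kn: "k ^ n = fps_const2 (1 / \<epsilon> ^ n)" for n by (simp add: k_def power_divide)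
    have "test_poly (k * ?X) (k * ?Y) (k\<^sup>2 * (?X * ?Y))
        = 1 + (k ^ 6 * (?X ^ 2 * ?Y ^ 4) + (k ^ 6 * (?X ^ 4 * ?Y ^ 2) + fps_const2 (- 3) * (k ^ 4 * (?X ^ 2 * ?Y ^ 2))))"
    proof -
      have "fps_const2 (- 3) = - 3"
        by (metis fps_const_neg fps_numeral_fps_const)
      then show ?thesis
        by (simp only: test_poly_scaled_product)
    qed
    then have "\<Lambda> (test_poly (k * ?X) (k * ?Y) (k\<^sup>2 * (?X * ?Y)))
        = 1 + (1 / \<epsilon> ^ 6 * W 2 4 + (1 / \<epsilon> ^ 6 * W 4 2 + (- 3) * (1 / \<epsilon> ^ 4 * W 2 2)))"
      using N6 by (simp only: add scale kn one mon)
    also have "\<dots> = 3 - 3 * R"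
    proof -
      \<comment> \<open>The heights are 0 at (1, 2) and (2, 1), and 1 at the raised centroid (1,
        1).\<close>
      have "w 2 4 = 1" "w 4 2 = 1" "w 2 2 = R"
        using N6 by (simp_all add: w_def moment_weight_def height_def bump_def)
      moreover have "W 2 4 = w 2 4 * \<epsilon> ^ 6" "W 4 2 = w 4 2 * \<epsilon> ^ 6" "W 2 2 = w 2 2 * \<epsilon> ^ 4"
        by (simp_all add: W_def eval_nat_numeral)
      ultimately show ?thesis using \<epsilon>(1) by simp
    qed
    also have "\<dots> < 0" using R by simp
    finally show "\<Lambda> (test_poly (fps_const2 (1 / \<epsilon>) * ?X) (fps_const2 (1 / \<epsilon>) * ?Y)
        (fps_const2 (1 / \<epsilon>\<^sup>2) * (?X * ?Y))) < 0"
      unfolding k2 k_def .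
  qed
qed

section \<open>Lifting pseudo-moments to the spectrahedron\<close>

text \<open>The series \<open>F\<close> is the polynomial \<open>P\<close>, of degree at most \<open>r\<close>, evaluated at the image of the
  point \<open>a\<close> under \<open>\<phi>\<close>, but with its real coefficients left unchanged: \<open>\<phi>\<close> is not linear over the
  reals.\<close>

inductive taylor_pair :: "(real \<Rightarrow> real fps fps) \<Rightarrow> real ^ 'n::finite \<Rightarrow> nat
    \<Rightarrow> (real ^ 'n \<Rightarrow> real) \<Rightarrow> real fps fps \<Rightarrow> bool" for \<phi> a r where
  monomial: "(\<Sum>i\<in>UNIV. \<alpha> i) \<le> r \<Longrightarrow> taylor_pair \<phi> a r (monomial_value \<alpha>) (\<phi> (monomial_value \<alpha> a))"
| scale: "taylor_pair \<phi> a r P F \<Longrightarrow> taylor_pair \<phi> a r (\<lambda>x. c * P x) (fps_const2 c * F)"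
| add: "taylor_pair \<phi> a r P F \<Longrightarrow> taylor_pair \<phi> a r Q G \<Longrightarrow> taylor_pair \<phi> a r (\<lambda>x. P x + Q x) (F + G)"

lemma taylor_pair_mono:
  assumes "taylor_pair \<phi> a r P F" "r \<le> s"
  shows "taylor_pair \<phi> a s P F"
  using assms by induction (auto intro: taylor_pair.intros)

lemma monomial_value_mult:
  "monomial_value \<alpha> x * monomial_value \<beta> x = monomial_value (\<lambda>i. \<alpha> i + \<beta> i) x"
  by (simp add: monomial_value_def power_add prod.distrib)

lemma taylor_pair_mult:
  assumes \<phi>: "ring_hom_fun \<phi>" and PF: "taylor_pair \<phi> a r P F" and QG: "taylor_pair \<phi> a s Q G"
  shows "taylor_pair \<phi> a (r + s) (\<lambda>x. P x * Q x) (F * G)"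
  using PF
proof induction
  case (monomial \<alpha>)
  from QG show ?case
  proof induction
    case (monomial \<beta>)
    have "\<phi> (monomial_value \<alpha> a) * \<phi> (monomial_value \<beta> a) = \<phi> (monomial_value (\<lambda>i. \<alpha> i + \<beta> i) a)"
      using \<phi> by (simp add: ring_hom_fun_def flip: monomial_value_mult)
    then show ?case
      using taylor_pair.monomial[of "\<lambda>i. \<alpha> i + \<beta> i" "r + s" \<phi> a] monomial \<open>sum \<alpha> UNIV \<le> r\<close>
      by (simp add: monomial_value_mult sum.distrib)
  next
    case (scale Q G c)
    from taylor_pair.scale[OF scale.IH, of c] show ?case by (simp add: mult_ac)
  next
    case (add Q G Q' G')
    from taylor_pair.add[OF add.IH] show ?case by (simp add: algebra_simps)
  qed
next
  case (scale P F c)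
  from taylor_pair.scale[OF scale.IH, of c] show ?case by (simp add: mult_ac)
next
  case (add P F P' F')
  from taylor_pair.add[OF add.IH] show ?case by (simp add: algebra_simps)
qed

lemma taylor_pair_const:
  assumes "ring_hom_fun \<phi>"
  shows "taylor_pair \<phi> a r (\<lambda>_. c) (fps_const2 c)"
proof -
  have "taylor_pair \<phi> a r (monomial_value (\<lambda>_. 0)) (\<phi> (monomial_value (\<lambda>_. 0) a))"
    by (intro taylor_pair.monomial) simp
  then have "taylor_pair \<phi> a r (\<lambda>_. 1) 1"
    using assms by (simp add: monomial_value_def[abs_def] ring_hom_fun_def)
  from taylor_pair.scale[OF this, of c] show ?thesis by simp
qed

lemma taylor_pair_component:
  assumes "1 \<le> r"
  shows "taylor_pair \<phi> a r (\<lambda>x. x $ i) (\<phi> (a $ i))"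
proof -
  define \<alpha> where "\<alpha> = (\<lambda>j. if j = i then 1 else 0 :: nat)"
  have "monomial_value \<alpha> x = x $ i" for x
    by (simp add: monomial_value_def \<alpha>_def if_distrib[of "\<lambda>n. _ ^ n"] cong: if_cong)
  moreover have "sum \<alpha> UNIV \<le> r" using assms by (simp add: \<alpha>_def)
  ultimately show ?thesis
    using taylor_pair.monomial[of \<alpha> r \<phi> a] by (metis (no_types, lifting) ext)
qed

text \<open>The degree bound is where the two cases of the theorem come from: \<open>e = 1\<close>
  gives 4 and \<open>e = 2\<close> gives 6.\<close>

lemma taylor_pair_test_poly:
  assumes \<phi>: "ring_hom_fun \<phi>" and "taylor_pair \<phi> a 1 X FX" "taylor_pair \<phi> a 1 Y FY"
    and "taylor_pair \<phi> a e Z FZ" "1 \<le> e"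
  shows "taylor_pair \<phi> a (2 + 2 * e) (\<lambda>x. test_poly (X x) (Y x) (Z x)) (test_poly FX FY FZ)"
proof -
  note mult = taylor_pair_mult[OF \<phi>]
  have XX: "taylor_pair \<phi> a 2 (\<lambda>x. X x * X x) (FX * FX)"
    and YY: "taylor_pair \<phi> a 2 (\<lambda>x. Y x * Y x) (FY * FY)"
    and XY: "taylor_pair \<phi> a 2 (\<lambda>x. X x * Y x) (FX * FY)"
    using mult[OF assms(2,2)] mult[OF assms(3,3)] mult[OF assms(2,3)] by (simp_all add: numeral_2_eq_2)
  have ZZ: "taylor_pair \<phi> a (2 * e) (\<lambda>x. Z x * Z x) (FZ * FZ)"
    using mult[OF assms(4,4)] by (simp add: mult_2)
  note const = taylor_pair_const[OF \<phi>]
  let ?r = "2 + 2 * e"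
  have 1: "taylor_pair \<phi> a ?r (\<lambda>x. X x * X x * (Y x * Y x)) (FX * FX * (FY * FY))"
    by (rule taylor_pair_mono[OF mult[OF XX YY]]) (use assms(5) in simp)
  have 2: "taylor_pair \<phi> a ?r (\<lambda>x. Y x * Y x * (Z x * Z x)) (FY * FY * (FZ * FZ))"
    by (rule mult[OF YY ZZ])
  have 3: "taylor_pair \<phi> a ?r (\<lambda>x. X x * X x * (Z x * Z x)) (FX * FX * (FZ * FZ))"
    by (rule mult[OF XX ZZ])
  have "taylor_pair \<phi> a ?r (\<lambda>x. X x * Y x * Z x) (FX * FY * FZ)"
    by (rule taylor_pair_mono[OF mult[OF XY assms(4)]]) (use assms(5) in simp)
  from taylor_pair.scale[OF this, of "- 4"]
  have 4: "taylor_pair \<phi> a ?r (\<lambda>x. - 4 * (X x * Y x * Z x)) (fps_const2 (- 4) * (FX * FY * FZ))" .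
  have n4: "fps_const2 (- 4) = - 4"
    by (metis fps_const_neg fps_numeral_fps_const)
  have t: "test_poly x y z = 1 + x * x * (y * y) + y * y * (z * z) + x * x * (z * z) + - 4 * (x * y * z)"
    for x y z :: "'b::comm_ring_1"
    by (simp add: test_poly_def power2_eq_square mult_ac)
  have "taylor_pair \<phi> a ?r (\<lambda>x. 1 + X x * X x * (Y x * Y x) + Y x * Y x * (Z x * Z x) + X x * X x * (Z x * Z x) + - 4 * (X x * Y x * Z x))
     (fps_const2 1 + FX * FX * (FY * FY) + FY * FY * (FZ * FZ) + FX * FX * (FZ * FZ) + fps_const2 (- 4) * (FX * FY * FZ))"
    by (intro taylor_pair.add const 1 2 3 4)
  then show ?thesis unfolding t n4 by simp
qed

text \<open>Turns a polynomial of degree at most \<open>d\<close> into an affine functional of the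
  monomial vector, with the same real coefficients for \<open>P\<close> and \<open>F\<close>. The
  zero exponent, absent from the range of \<open>m\<close>, gives the constant term.\<close>

lemma taylor_pair_expansion:
  fixes m :: "'N::finite \<Rightarrow> 'n::finite \<Rightarrow> nat"
  assumes \<phi>: "ring_hom_fun \<phi>" and m: "bij_betw m UNIV (nonconst_monomials d)"
    and "taylor_pair \<phi> a d P F"
  shows "\<exists>c0 c. (\<forall>x. P x = c0 + (\<Sum>j\<in>UNIV. c j * monomial_map m x $ j))
    \<and> F = fps_const2 c0 + (\<Sum>j\<in>UNIV. fps_const2 (c j) * \<phi> (monomial_map m a $ j))"
  using assms(3)
proof induction
  case (monomial \<alpha>)
  show ?case
  proof (cases "\<alpha> \<in> nonconst_monomials d")
    case True
    then obtain j where j: "\<alpha> = m j" using m unfolding bij_betw_def by blast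
    have "(\<Sum>i\<in>UNIV. fps_const2 (if i = j then 1 else 0) * \<phi> (monomial_map m a $ i)) = \<phi> (monomial_value \<alpha> a)"
    proof -
      have "(\<Sum>i\<in>UNIV. fps_const2 (if i = j then 1 else 0) * \<phi> (monomial_map m a $ i))
          = (\<Sum>i\<in>UNIV. if i = j then \<phi> (monomial_map m a $ i) else 0)"
        by (intro sum.cong) auto
      then show ?thesis by (simp add: monomial_map_def j)
    qed
    moreover have "monomial_value \<alpha> x = (\<Sum>i\<in>UNIV. (if i = j then 1 else 0) * monomial_map m x $ i)" for x
      by (simp add: monomial_map_def j if_distrib[of "\<lambda>z. z * _"] cong: if_cong)
    ultimately show ?thesis
      by (intro exI[of _ 0] exI[of _ "\<lambda>i. if i = j then 1 else 0"]) simp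
  next
    case False
    then have "\<alpha> = (\<lambda>_. 0)" using monomial by (auto simp: nonconst_monomials_def not_le)
    then show ?thesis
      using \<phi> by (intro exI[of _ 1] exI[of _ "\<lambda>_. 0"]) (simp add: monomial_value_def ring_hom_fun_def)
  qed
next
  case (scale P F c)
  then obtain c0 c' where "\<And>x. P x = c0 + (\<Sum>j\<in>UNIV. c' j * monomial_map m x $ j)"
    "F = fps_const2 c0 + (\<Sum>j\<in>UNIV. fps_const2 (c' j) * \<phi> (monomial_map m a $ j))" by blast
  then show ?case
    by (intro exI[of _ "c * c0"] exI[of _ "\<lambda>j. c * c' j"])
       (simp add: distrib_left sum_distrib_left flip: fps_const_mult mult.assoc)
next
  case (add P F Q G)
  then obtain c0 c c0' c' where "\<And>x. P x = c0 + (\<Sum>j\<in>UNIV. c j * monomial_map m x $ j)"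
    "F = fps_const2 c0 + (\<Sum>j\<in>UNIV. fps_const2 (c j) * \<phi> (monomial_map m a $ j))"
    "\<And>x. Q x = c0' + (\<Sum>j\<in>UNIV. c' j * monomial_map m x $ j)"
    "G = fps_const2 c0' + (\<Sum>j\<in>UNIV. fps_const2 (c' j) * \<phi> (monomial_map m a $ j))" by blast
  then show ?case
    by (intro exI[of _ "c0 + c0'"] exI[of _ "\<lambda>j. c j + c' j"])
       (simp add: distrib_right sum.distrib flip: fps_const_add)
qed

text \<open>The quartic is not a sum of squares, so two weighted representations are used, one for
  each sign of \<open>x * y\<close>.\<close>

lemma test_poly_nonneg:
  fixes x y z :: real
  shows "0 \<le> test_poly x y z"
proof -
  have 1: "test_poly x y z = (1 - x * y)\<^sup>2 + 2 * (x * y) * (1 - z)\<^sup>2 + (y * z - z * x)\<^sup>2"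
    and 2: "test_poly x y z = (1 + x * y)\<^sup>2 - 2 * (x * y) * (1 + z)\<^sup>2 + (y * z + z * x)\<^sup>2"
    by (simp_all add: test_poly_def power2_eq_square algebra_simps)
  show ?thesis
  proof (cases "0 \<le> x * y")
    case True
    then show ?thesis unfolding 1 by simp
  next
    case False
    then have "2 * (x * y) \<le> 0" by linarith
    then have "2 * (x * y) * (1 + z)\<^sup>2 \<le> 0" by (rule mult_nonpos_nonneg) simp
    then show ?thesis unfolding 2
      using zero_le_power2[of "1 + x * y"] zero_le_power2[of "y * z + z * x"] by linarith
  qed
qed

lemma nonneg_on_closed_convex_hull:
  fixes c :: "'N::finite \<Rightarrow> real"
  assumes "\<And>\<eta>. \<eta> \<in> V \<Longrightarrow> 0 \<le> c0 + (\<Sum>j\<in>UNIV. c j * \<eta> $ j)" and "\<eta> \<in> closure (convex hull V)"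
  shows "0 \<le> c0 + (\<Sum>j\<in>UNIV. c j * \<eta> $ j)"
proof -
  define H where "H = {\<eta>. - c0 \<le> inner (\<chi> j. c j) \<eta>}"
  have H: "\<eta> \<in> H \<longleftrightarrow> 0 \<le> c0 + (\<Sum>j\<in>UNIV. c j * \<eta> $ j)" for \<eta>
    by (auto simp: H_def inner_vec_def)
  have "closure (convex hull V) \<subseteq> H"
  proof (rule closure_minimal, rule hull_minimal)
    show "V \<subseteq> H" using assms(1) H by blast
    show "convex H" "closed H"
      unfolding H_def using convex_halfspace_ge closed_halfspace_ge by blast+
  qed
  then show ?thesis using assms(2) H by blast
qed

lemma linear_from_expansion:
  fixes f :: "real Matrix.vec \<Rightarrow> real ^ 'N"
  assumes f: "linear_from M f" and x: "x \<in> carrier_vec M"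
  shows "f x = (\<Sum>i<M. vec_index x i *\<^sub>R f (unit_vec M i))"
proof -
  have add: "f (u + v) = f u + f v" if "u \<in> carrier_vec M" "v \<in> carrier_vec M" for u v
    using f that unfolding linear_from_def by blast
  have scale: "f (c \<cdot>\<^sub>v u) = c *\<^sub>R f u" if "u \<in> carrier_vec M" for c u
    using f that unfolding linear_from_def by blast
  \<comment> \<open>Truncations of \<open>x\<close> let additivity act one coordinate at a
    time.\<close>
  define t where "t m = Matrix.vec M (\<lambda>i. if i < m then vec_index x i else 0)" for m
  have t: "t m \<in> carrier_vec M" for m by (simp add: t_def)
  have "f (t m) = (\<Sum>i<m. vec_index x i *\<^sub>R f (unit_vec M i))" if "m \<le> M" for m
    using that
  proof (induction m)
    case 0
    have "t 0 = 0 \<cdot>\<^sub>v t 0" by (intro eq_vecI) (simp_all add: t_def)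
    then have "f (t 0) = 0 *\<^sub>R f (t 0)" using scale[OF t, of 0] by metis
    then show ?case by simp
  next
    case (Suc m)
    have "t (Suc m) = t m + vec_index x m \<cdot>\<^sub>v unit_vec M m"
      using Suc.prems by (intro eq_vecI) (auto simp: t_def less_Suc_eq)
    then show ?case using Suc by (simp add: add scale t)
  qed
  moreover have "t M = x" using x by (intro eq_vecI) (auto simp: t_def)
  ultimately show ?thesis by force
qed

lemma psd_mat_iff:
  "psd_mat e B \<longleftrightarrow> B \<in> carrier_mat e e \<and> (\<forall>r<e. \<forall>s<e. B $$ (r, s) = B $$ (s, r))
     \<and> (\<forall>v. 0 \<le> (\<Sum>r<e. \<Sum>s<e. v r * v s * B $$ (r, s)))"
proof (cases "B \<in> carrier_mat e e")
  case B: True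
  have sym: "B\<^sup>T = B \<longleftrightarrow> (\<forall>r<e. \<forall>s<e. B $$ (r, s) = B $$ (s, r))"
    using B by (auto simp: mat_eq_iff)
  have q: "v \<bullet> (B *\<^sub>v v) = (\<Sum>r<e. \<Sum>s<e. vec_index v r * vec_index v s * B $$ (r, s))"
    if "v \<in> carrier_vec e" for v
    using that B
    by (simp add: scalar_prod_def mult_mat_vec_def sum_distrib_left atLeast0LessThan mult_ac)
  have "(\<forall>v\<in>carrier_vec e. v \<bullet> (B *\<^sub>v v) \<ge> 0)
      \<longleftrightarrow> (\<forall>v. 0 \<le> (\<Sum>r<e. \<Sum>s<e. v r * v s * B $$ (r, s)))"
  proof (intro iffI allI ballI)
    fix v :: "nat \<Rightarrow> real"
    assume "\<forall>v\<in>carrier_vec e. v \<bullet> (B *\<^sub>v v) \<ge> 0"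
    then have "0 \<le> Matrix.vec e v \<bullet> (B *\<^sub>v Matrix.vec e v)" by simp
    then show "0 \<le> (\<Sum>r<e. \<Sum>s<e. v r * v s * B $$ (r, s))" by (subst (asm) q) simp_all
  next
    fix v :: "real Matrix.vec"
    assume *: "\<forall>v. 0 \<le> (\<Sum>r<e. \<Sum>s<e. v r * v s * B $$ (r, s))" and v: "v \<in> carrier_vec e"
    show "v \<bullet> (B *\<^sub>v v) \<ge> 0" unfolding q[OF v] using * by blast
  qed
  with B sym show ?thesis by (simp add: psd_mat_def symmetric_mat_def)
qed (simp add: psd_mat_def symmetric_mat_def)

section \<open>Generic points and the final contradiction\<close>

text \<open>When \<open>6 \<le> d\<close>, the index \<open>i3\<close> carries no condition: the
  product of two coordinates will then replace the third.\<close>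

lemma exists_coordinate_triple:
  fixes d :: nat
  assumes "(CARD('n::finite) \<ge> 3 \<and> d \<ge> 4) \<or> (CARD('n::finite) = 2 \<and> d \<ge> 6)"
  obtains i1 i2 i3 :: "'n::finite" where "i1 \<noteq> i2" "(i3 \<noteq> i1 \<and> i3 \<noteq> i2 \<and> 4 \<le> d) \<or> 6 \<le> d"
  using assms
proof
  assume *: "CARD('n) \<ge> 3 \<and> d \<ge> 4"
  then obtain T :: "'n set" where "card T = 3"
    using obtain_subset_with_card_n[of 3 "UNIV :: 'n set"] by metis
  then show ?thesis using that * by (metis card_3_iff)
next
  assume *: "CARD('n) = 2 \<and> d \<ge> 6"
  then obtain i1 i2 :: 'n where "i1 \<noteq> i2" by (metis card_2_iff)
  then show ?thesis using that * by blast
qed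

text \<open>Each coordinate is perturbed by less than r / n, so the l1 norm keeps the point in the
  ball of radius r. If indices coincide, the earlier one takes precedence.\<close>

lemma exists_generic_point:
  fixes y :: "real ^ 'n::finite"
  assumes "y \<in> interior S" "countable k"
  obtains a1 a2 a3 where "transcendental_over k a1" "transcendental_over (ring_adjoin k a1) a2"
    "transcendental_over (ring_adjoin (ring_adjoin k a1) a2) a3"
    "(\<chi> i. if i = i1 then a1 else if i = i2 then a2 else if i = i3 then a3 else y $ i) \<in> S"
proof -
  obtain r where r: "0 < r" "ball y r \<subseteq> S"
    using assms(1) unfolding mem_interior by blast
  define \<delta> where "\<delta> = r / real CARD('n)"
  have \<delta>: "0 < \<delta>" using r by (simp add: \<delta>_def)
  have ex: "\<exists>a. transcendental_over l a \<and> \<bar>y $ i - a\<bar> < \<delta>" if "countable l" for l i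
    using exists_transcendental[OF that, of "y $ i - \<delta>" "y $ i + \<delta>"] \<delta> by (force simp: abs_less_iff)
  obtain a1 where a1: "transcendental_over k a1" "\<bar>y $ i1 - a1\<bar> < \<delta>"
    using ex[OF assms(2), of i1] by auto
  obtain a2 where a2: "transcendental_over (ring_adjoin k a1) a2" "\<bar>y $ i2 - a2\<bar> < \<delta>"
    using ex[OF countable_ring_adjoin[OF assms(2), of a1], of i2] by auto
  obtain a3 where a3: "transcendental_over (ring_adjoin (ring_adjoin k a1) a2) a3" "\<bar>y $ i3 - a3\<bar> < \<delta>"
    using ex[OF countable_ring_adjoin[OF countable_ring_adjoin[OF assms(2), of a1], of a2], of i3] by auto
  define x :: "real ^ 'n" where
    "x = (\<chi> i. if i = i1 then a1 else if i = i2 then a2 else if i = i3 then a3 else y $ i)"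
  have "norm (y - x) \<le> (\<Sum>i\<in>UNIV. \<bar>(y - x) $ i\<bar>)" by (rule norm_le_l1_cart)
  also have "\<dots> < (\<Sum>i\<in>(UNIV :: 'n set). \<delta>)"
    using a1(2) a2(2) a3(2) \<delta> by (intro sum_strict_mono) (auto simp: x_def)
  also have "\<dots> = r" by (simp add: \<delta>_def)
  finally have "x \<in> S" using r(2) by (auto simp: dist_norm)
  then show ?thesis using that a1(1) a2(1) a3(1) unfolding x_def by blast
qed

theorem corollary4p24:
  fixes d :: nat
    and m :: "'N::finite \<Rightarrow> 'n::finite \<Rightarrow> nat"
    and S :: "(real ^ 'n) set"
  assumes "(CARD('n) \<ge> 3 \<and> d \<ge> 4) \<or> (CARD('n) = 2 \<and> d \<ge> 6)"
    and "bij_betw m UNIV (nonconst_monomials d)"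
    and "semialgebraic S"
    and "interior S \<noteq> {}"
  shows "\<not> spectrahedral_shadow (closure (convex hull (monomial_map m ` S)))"
proof
  define V where "V = closure (convex hull (monomial_map m ` S))"
  assume "spectrahedral_shadow (closure (convex hull (monomial_map m ` S)))"
  then obtain M T f where T: "spectrahedron M T" and f: "linear_from M f" and VT: "V = f ` T"
    unfolding spectrahedral_shadow_def V_def by blast
  from T obtain e A where T: "T = {\<xi> \<in> carrier_vec M. psd_mat e (linear_pencil e M A \<xi>)}"
    unfolding spectrahedron_def by blast
  obtain y where y: "y \<in> interior S" using assms(4) by blast
  obtain i1 i2 i3 :: 'n where i: "i1 \<noteq> i2" "(i3 \<noteq> i1 \<and> i3 \<noteq> i2 \<and> 4 \<le> d) \<or> 6 \<le> d"
    using exists_coordinate_triple[OF assms(1)] by blast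
  define Y where "Y = (\<lambda>(i, r, s). A i $$ (r, s)) ` ({..M} \<times> {..<e} \<times> {..<e})
    \<union> (\<lambda>(i, j). f (unit_vec M i) $ j) ` ({..<M} \<times> UNIV)"
  define k where "k = ring_hull Y"
  have "countable Y" unfolding Y_def by (intro countable_Un countable_finite finite_imageI) auto
  then have ck: "countable k" unfolding k_def by (rule countable_ring_hull)
  have sk: "subring_set k" unfolding k_def by (rule subring_set_ring_hull)
  have Yk: "x \<in> k" if "x \<in> Y" for x using that unfolding k_def by (rule ring_hull.base)
  have kA: "A i $$ (r, s) \<in> k" if "i \<le> M" "r < e" "s < e" for i r s
    using that by (intro Yk) (force simp: Y_def)
  have kf: "f (unit_vec M i) $ j \<in> k" if "i < M" for i j
    using that by (intro Yk) (force simp: Y_def)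
  obtain a1 a2 a3 where a: "transcendental_over k a1" "transcendental_over (ring_adjoin k a1) a2"
    "transcendental_over (ring_adjoin (ring_adjoin k a1) a2) a3"
    and xS: "(\<chi> i. if i = i1 then a1 else if i = i2 then a2 else if i = i3 then a3 else y $ i) \<in> S"
    using exists_generic_point[OF y ck] .
  define x where "x = (\<chi> i. if i = i1 then a1 else if i = i2 then a2 else if i = i3 then a3 else y $ i)"
  have x1: "x $ i1 = a1" and x2: "x $ i2 = a2" and x3: "i3 \<noteq> i1 \<Longrightarrow> i3 \<noteq> i2 \<Longrightarrow> x $ i3 = a3"
    using i(1) by (simp_all add: x_def)
  \<comment> \<open>The choice \<open>D2 a3 = a1\<close> puts a multiple of \<open>t\<^sub>1 t\<^sub>2\<close> into the series of \<open>a3\<close>: up to an affine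
    change of coordinates the third coordinate becomes the product of the first two.\<close>
  obtain D1 where D1: "derivation D1" "\<And>c. c \<in> k \<Longrightarrow> D1 c = 0" "D1 a1 = 1" "D1 a2 = 0" "D1 a3 = 0"
    using exists_derivation[OF sk a, of 1 0 0] unfolding derivation_def by metis
  obtain D2 where D2: "derivation D2" "\<And>c. c \<in> k \<Longrightarrow> D2 c = 0" "D2 a1 = 0" "D2 a2 = 1" "D2 a3 = a1"
    using exists_derivation[OF sk a, of 0 1 a1] unfolding derivation_def by metis
  define \<phi> where "\<phi> = exp_derivation2 D1 D2"
  have \<phi>: "ring_hom_fun \<phi>" unfolding \<phi>_def by (rule ring_hom_exp_derivation2[OF D1(1) D2(1)])
  have \<phi>k: "\<phi> c = fps_const2 c" if "c \<in> k" for c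
    unfolding \<phi>_def using D1 D2 that by (intro exp_derivation2_const) auto
  let ?X = "fps_const fps_X :: real fps fps" and ?Y = "fps_X :: real fps fps"
  have E0: "exp_derivation D1 0 = 0" "exp_derivation D1 1 = 1"
    using ring_hom_fun_zero ring_hom_exp_derivation[OF D1(1)] by (auto simp: ring_hom_fun_def)
  have E1: "exp_derivation D1 a1 = fps_const a1 + fps_X"
    using exp_derivation_linear[OF D1(1,3) derivation_1[OF D1(1)]] by simp
  have \<phi>1: "\<phi> a1 = fps_const2 a1 + ?X"
    using exp_derivation2_linear[OF D1(1) D2(1,3) derivation_0[OF D2(1)]] by (simp add: \<phi>_def E0 E1)
  have \<phi>2: "\<phi> a2 = fps_const2 a2 + ?Y"
    using exp_derivation2_linear[OF D1(1) D2(1,4) derivation_1[OF D2(1)]] exp_derivation_const[OF D1(1,4)]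
    by (simp add: \<phi>_def E0)
  have \<phi>3: "\<phi> a3 = fps_const2 a3 + (fps_const2 a1 + ?X) * ?Y"
    using exp_derivation2_linear[OF D1(1) D2(1,5,3)] exp_derivation_const[OF D1(1,5)]
    by (simp add: \<phi>_def E1)

  have "monomial_map m x \<in> V"
    unfolding V_def x_def using xS by (intro subsetD[OF closure_subset] hull_inc imageI)
  then obtain \<xi> where \<xi>: "\<xi> \<in> carrier_vec M" and psd: "psd_mat e (linear_pencil e M A \<xi>)"
    and f\<xi>: "f \<xi> = monomial_map m x"
    unfolding VT T by force
  define a where "a r s = A 0 $$ (r, s) + (\<Sum>i = 1..M. vec_index \<xi> (i - 1) * A i $$ (r, s))" for r s
  have pencil: "linear_pencil e M A \<xi> $$ (r, s) = a r s" if "r < e" "s < e" for r s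
    using that by (simp add: linear_pencil_def a_def)
  obtain C where C: "\<And>r s. r < e \<Longrightarrow> s < e \<Longrightarrow> a r s = (\<Sum>l<e. C l r * C l s)"
  proof -
    have "\<exists>C. \<forall>r<e. \<forall>s<e. a r s = (\<Sum>l<e. C l r * C l s)"
      using psd unfolding psd_mat_iff by (intro psd_factorization) (simp_all add: pencil)
    then show ?thesis using that by blast
  qed
  obtain \<Lambda> :: "real fps fps \<Rightarrow> real" and \<epsilon> :: real where \<epsilon>: "\<epsilon> > 0"
    and \<Lambda>_add: "\<And>G H. \<Lambda> (G + H) = \<Lambda> G + \<Lambda> H"
    and \<Lambda>_scale: "\<And>c G. \<Lambda> (fps_const2 c * G) = c * \<Lambda> G"
    and \<Lambda>_1: "\<Lambda> 1 = 1"
    and \<Lambda>_square: "\<And>b. 0 \<le> \<Lambda> ((\<Sum>i\<in>{..<e} \<times> {..<e}. fps_const2 (b i) * \<phi> (C (fst i) (snd i)))\<^sup>2)"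
    and \<Lambda>_test: "\<Lambda> (test_poly (fps_const2 (1 / \<epsilon>) * ?X) (fps_const2 (1 / \<epsilon>) * ?Y)
        (fps_const2 (1 / \<epsilon>\<^sup>2) * (?X * ?Y))) < 0"
  proof (rule exists_pseudo_moment_functional[of "{..<e} \<times> {..<e}" "\<lambda>i. \<phi> (C (fst i) (snd i))"])
    show "finite ({..<e} \<times> {..<e})" by simp
  qed (rule that; assumption)
  have \<Lambda>_const: "\<Lambda> (fps_const2 c) = c" for c using \<Lambda>_scale[of c 1] \<Lambda>_1 by simp
  have \<Lambda>_0: "\<Lambda> 0 = 0" using \<Lambda>_const[of 0] by simp
  have \<Lambda>_sum: "\<Lambda> (sum g I) = (\<Sum>i\<in>I. \<Lambda> (g i))" for g and I :: "'i set"
    by (induction I rule: infinite_finite_induct) (simp_all add: \<Lambda>_0 \<Lambda>_add)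
  \<comment> \<open>This map is additive and linear over \<open>k\<close>, though not over the
    reals; that suffices, as the pencil and \<open>f\<close> have their coefficients in
    \<open>k\<close>.\<close>
  define \<psi> where "\<psi> c = \<Lambda> (\<phi> c)" for c
  have \<psi>_add: "\<psi> (b + c) = \<psi> b + \<psi> c" for b c
    using \<phi> by (simp add: \<psi>_def ring_hom_fun_def \<Lambda>_add)
  have \<psi>_k: "\<psi> c = c" if "c \<in> k" for c using that by (simp add: \<psi>_def \<phi>k \<Lambda>_const)
  have \<psi>_mult: "\<psi> (b * c) = \<psi> b * c" if "c \<in> k" for b c
  proof -
    have "\<phi> (b * c) = fps_const2 c * \<phi> b"
      using \<phi> \<phi>k[OF that] by (simp add: ring_hom_fun_def mult.commute)
    then show ?thesis by (simp add: \<psi>_def \<Lambda>_scale)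
  qed
  have \<psi>_sum: "\<psi> (sum g I) = (\<Sum>i\<in>I. \<psi> (g i))" for g and I :: "'i set"
    by (simp add: \<psi>_def ring_hom_fun_sum[OF \<phi>] \<Lambda>_sum)

  define \<xi>' where "\<xi>' = Matrix.vec M (\<lambda>i. \<psi> (vec_index \<xi> i))"
  have \<xi>': "\<xi>' \<in> carrier_vec M" by (simp add: \<xi>'_def)
  have pencil': "linear_pencil e M A \<xi>' $$ (r, s) = \<psi> (a r s)" if "r < e" "s < e" for r s
  proof -
    have "vec_index \<xi>' (i - 1) * A i $$ (r, s) = \<psi> (vec_index \<xi> (i - 1) * A i $$ (r, s))"
      if "i \<in> {1..M}" for i
      using that \<open>r < e\<close> \<open>s < e\<close> by (subst \<psi>_mult[OF kA]) (auto simp: \<xi>'_def)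
    then show ?thesis
      using that by (simp add: linear_pencil_def a_def \<psi>_add \<psi>_sum \<psi>_k[OF kA])
  qed
  have "psd_mat e (linear_pencil e M A \<xi>')"
    unfolding psd_mat_iff
  proof (intro conjI allI impI)
    show "linear_pencil e M A \<xi>' \<in> carrier_mat e e" by (simp add: linear_pencil_def)
    show "linear_pencil e M A \<xi>' $$ (r, s) = linear_pencil e M A \<xi>' $$ (s, r)" if "r < e" "s < e" for r s
      using that by (simp add: pencil' C mult.commute)
    fix v :: "nat \<Rightarrow> real"
    \<comment> \<open>The pencil at \<open>\<xi>'\<close>, as a quadratic form in \<open>v\<close>,
      is the sum of the \<Lambda>-values of the squares of the \<open>G l\<close>. The real scalars
      \<open>v s\<close> are not moved by \<phi>.\<close>
    define G where "G l = (\<Sum>s<e. fps_const2 (v s) * \<phi> (C l s))" for l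
    have G: "0 \<le> \<Lambda> (G l * G l)" if "l < e" for l
    proof -
      \<comment> \<open>Selects row \<open>l\<close> from the family indexed by pairs.\<close>
      define b where "b i = (if fst i = l then v (snd i) else 0)" for i :: "nat \<times> nat"
      have "(\<Sum>i\<in>{..<e} \<times> {..<e}. fps_const2 (b i) * \<phi> (C (fst i) (snd i)))
          = (\<Sum>l'<e. \<Sum>s<e. if l' = l then fps_const2 (v s) * \<phi> (C l s) else 0)"
        unfolding sum.cartesian_product by (intro sum.cong) (auto simp: b_def)
      also have "\<dots> = (\<Sum>l'<e. if l' = l then G l else 0)"
        by (intro sum.cong) (auto simp: G_def)
      also have "\<dots> = G l" using that by simp
      finally show ?thesis using \<Lambda>_square[of b] by (simp add: power2_eq_square)
    qed
    have "\<Lambda> (G l * G l) = (\<Sum>r<e. \<Sum>s<e. v r * v s * \<psi> (C l r * C l s))" for l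
    proof -
      have "fps_const2 (v r) * \<phi> (C l r) * (fps_const2 (v s) * \<phi> (C l s))
          = fps_const2 (v r) * (fps_const2 (v s) * \<phi> (C l r * C l s))" for r s
        using \<phi> by (simp add: ring_hom_fun_def mult_ac)
      then show ?thesis
        unfolding G_def sum_product \<Lambda>_sum \<psi>_def by (simp only: \<Lambda>_scale mult.assoc)
    qed
    then have "(\<Sum>l<e. \<Lambda> (G l * G l)) = (\<Sum>l<e. \<Sum>r<e. \<Sum>s<e. v r * v s * \<psi> (C l r * C l s))"
      by simp
    also have "\<dots> = (\<Sum>r<e. \<Sum>l<e. \<Sum>s<e. v r * v s * \<psi> (C l r * C l s))"
      by (rule sum.swap)
    also have "\<dots> = (\<Sum>r<e. \<Sum>s<e. \<Sum>l<e. v r * v s * \<psi> (C l r * C l s))"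
      by (rule sum.cong[OF refl], rule sum.swap)
    also have "\<dots> = (\<Sum>r<e. \<Sum>s<e. v r * v s * linear_pencil e M A \<xi>' $$ (r, s))"
      by (intro sum.cong refl) (simp add: pencil' C \<psi>_sum sum_distrib_left)
    finally show "0 \<le> (\<Sum>r<e. \<Sum>s<e. v r * v s * linear_pencil e M A \<xi>' $$ (r, s))"
      using G by (metis (no_types, lifting) lessThan_iff sum_nonneg)
  qed
  then have "f \<xi>' \<in> V" using \<xi>' by (simp add: VT T)
  have f\<xi>': "f \<xi>' $ j = \<psi> (monomial_map m x $ j)" for j
  proof -
    have "f \<xi>' $ j = (\<Sum>i<M. \<psi> (vec_index \<xi> i) * f (unit_vec M i) $ j)"
      unfolding linear_from_expansion[OF f \<xi>'] by (simp add: \<xi>'_def)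
    also have "\<dots> = \<psi> (\<Sum>i<M. vec_index \<xi> i * f (unit_vec M i) $ j)"
      unfolding \<psi>_sum by (intro sum.cong) (simp_all add: \<psi>_mult kf)
    also have "\<dots> = \<psi> (f \<xi> $ j)"
      unfolding linear_from_expansion[OF f \<xi>] by simp
    finally show ?thesis by (simp add: f\<xi>)
  qed

  \<comment> \<open>The coefficient \<open>- a1\<close> stays fixed and cancels the constant term of
    \<open>\<phi> a1\<close>, so \<open>X\<close> corresponds to a pure multiple of the inner
    variable; likewise \<open>Y'\<close> and the outer one.\<close>
  define X where "X = (\<lambda>z :: real ^ 'n. 1 / \<epsilon> * (z $ i1 + (- a1)))"
  define Y' where "Y' = (\<lambda>z :: real ^ 'n. 1 / \<epsilon> * (z $ i2 + (- a2)))"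
  note comp = taylor_pair_component[of 1 \<phi> x, OF order_refl] and const = taylor_pair_const[OF \<phi>]
  have tX: "taylor_pair \<phi> x 1 X (fps_const2 (1 / \<epsilon>) * ?X)"
    using taylor_pair.scale[OF taylor_pair.add[OF comp[of i1] const[of x 1 "- a1"]], of "1 / \<epsilon>"]
    by (simp add: X_def x1 \<phi>1 flip: fps_const_neg)
  have tY: "taylor_pair \<phi> x 1 Y' (fps_const2 (1 / \<epsilon>) * ?Y)"
    using taylor_pair.scale[OF taylor_pair.add[OF comp[of i2] const[of x 1 "- a2"]], of "1 / \<epsilon>"]
    by (simp add: Y'_def x2 \<phi>2 flip: fps_const_neg)
  have "\<exists>r Z. 1 \<le> r \<and> 2 + 2 * r \<le> d \<and> taylor_pair \<phi> x r Z (fps_const2 (1 / \<epsilon>\<^sup>2) * (?X * ?Y))"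
    using i(2)
  proof
    assume i3: "i3 \<noteq> i1 \<and> i3 \<noteq> i2 \<and> 4 \<le> d"
    \<comment> \<open>With a third independent coordinate, \<open>?X * ?Y\<close> comes from a
      polynomial of degree 1: subtracting \<open>a3\<close> and \<open>a1\<close> times the second
      increment from \<open>\<phi> a3\<close> leaves just this product.\<close>
    have "taylor_pair \<phi> x 1 (\<lambda>z. 1 / \<epsilon>\<^sup>2 * (z $ i3 + (- a1 * (z $ i2 + (- a2)) + (- a3))))
        (fps_const2 (1 / \<epsilon>\<^sup>2) * (\<phi> (x $ i3) + (fps_const2 (- a1) * (\<phi> (x $ i2) + fps_const2 (- a2)) + fps_const2 (- a3))))"
      by (intro taylor_pair.scale taylor_pair.add comp const)
    moreover have "\<phi> (x $ i3) + (fps_const2 (- a1) * (\<phi> (x $ i2) + fps_const2 (- a2)) + fps_const2 (- a3)) = ?X * ?Y"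
      using i3 by (simp add: x2 x3 \<phi>2 \<phi>3 algebra_simps flip: fps_const_neg)
    ultimately show ?thesis using i3 by (intro exI[of _ 1]) auto
  next
    assume "6 \<le> d"
    have "fps_const2 (1 / \<epsilon>) * ?X * (fps_const2 (1 / \<epsilon>) * ?Y) = fps_const2 (1 / \<epsilon>\<^sup>2) * (?X * ?Y)"
    proof -
      have "fps_const2 (1 / \<epsilon>\<^sup>2) = fps_const2 (1 / \<epsilon>) * fps_const2 (1 / \<epsilon>)"
        by (simp add: power2_eq_square)
      then show ?thesis by (simp only: mult_ac)
    qed
    then have "taylor_pair \<phi> x 2 (\<lambda>z. X z * Y' z) (fps_const2 (1 / \<epsilon>\<^sup>2) * (?X * ?Y))"
      using taylor_pair_mult[OF \<phi> tX tY] by (simp only: one_add_one)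
    then show ?thesis using \<open>6 \<le> d\<close> by (intro exI[of _ 2]) auto
  qed
  then obtain r Z where r: "1 \<le> r" "2 + 2 * r \<le> d"
    and tZ: "taylor_pair \<phi> x r Z (fps_const2 (1 / \<epsilon>\<^sup>2) * (?X * ?Y))" by blast
  let ?F = "test_poly (fps_const2 (1 / \<epsilon>) * ?X) (fps_const2 (1 / \<epsilon>) * ?Y) (fps_const2 (1 / \<epsilon>\<^sup>2) * (?X * ?Y))"
  have "taylor_pair \<phi> x d (\<lambda>z. test_poly (X z) (Y' z) (Z z)) ?F"
    using taylor_pair_mono[OF taylor_pair_test_poly[OF \<phi> tX tY tZ r(1)] r(2)] .
  from taylor_pair_expansion[OF \<phi> assms(2) this] obtain c0 c
    where P: "\<And>z. test_poly (X z) (Y' z) (Z z) = c0 + (\<Sum>j\<in>UNIV. c j * monomial_map m z $ j)"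
      and F: "?F = fps_const2 c0 + (\<Sum>j\<in>UNIV. fps_const2 (c j) * \<phi> (monomial_map m x $ j))"
    by blast
  \<comment> \<open>The affine functional is nonnegative on the hull, but its value at
    \<open>f \<xi>'\<close> is the negative pseudo-expectation of the test polynomial.\<close>
  have "0 \<le> c0 + (\<Sum>j\<in>UNIV. c j * f \<xi>' $ j)"
    using \<open>f \<xi>' \<in> V\<close> unfolding V_def
    by (rule nonneg_on_closed_convex_hull[rotated]) (auto simp: test_poly_nonneg simp flip: P)
  also have "\<dots> = \<Lambda> ?F"
    unfolding F f\<xi>' by (simp add: \<Lambda>_add \<Lambda>_const \<Lambda>_sum \<Lambda>_scale \<psi>_def)
  finally show False using \<Lambda>_test by simp
qed

end
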